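(* Let $p$ be a prime, $l\ge 1$ an integer, and let $f\colon\mathbb{Z}_p\to\mathbb{Q}_p$ be an analytic function that is not identically zero. Let $\mathcal{R}_f\subset\mathbb{Z}_p$ be the set of roots of $f$ in $\mathbb{Z}_p$. Then the sequence $(\nu_{p^l}(f(n)))_{n\ge 0}$ is (a) periodic if $\mathcal{R}_f=\varnothing$, and a power of $p$ can be chosen as a period; (b) strictly $p$-regular if $\varnothing\ne\mathcal{R}_f\subset\mathbb{Q}$; (c) not regular if $\mathcal{R}_f\not\subset\mathbb{Q}$. In particular, these conditions do not depend on $l$.
   Context: $\mathbb{N}=\{0,1,2,\ldots\}$. A function $f\colon\mathbb{Z}_p\to\mathbb{Q}_p$ is analytic if it is given by a single Taylor (power) series convergent on all of $\mathbb{Z}_p$. For $x\in\mathbb{Q}_p$ put $\nu_{p^l}(x)=\lfloor\nu_p(x)/l\rfloor$, with $\nu_{p^l}(0)=+\infty$. For an integer $k\ge2$, the $k$-kernel of a sequence $\mathbf{a}=(a_n)_{n\ge0}$ is $\{(a_{k^in+j})_{n\ge0}: i\ge0,\ 0\le j\le k^i-1\}$. A sequence with values in a $\mathbb{Z}$-module $R$ is $k$-regular if the $\mathbb{Z}$-submodule of $R^{\mathbb{N}}$ generated by its $k$-kernel is finitely generated. It is regular if it is $k$-regular for some $k\ge2$. It is strictly $k$-regular if it is $k$-regular and is not $m$-regular for any integer $m\ge2$ multiplicatively independent of $k$ (i.e. with $k^a\neq m^c$ for all integers $a,c\ge1$). A period need not be minimal. Convention: $f$ may have (finitely many) roots in $\mathbb{N}$;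 the terms $+\infty$ occurring at such $n$ are replaced by arbitrary integers, which does not affect regularity. *)

theory Defs
  imports
    Complex_Main
    "HOL-Library.Cardinality"
    "HOL-Library.Extended"
    "HOL-Library.Function_Algebras"
    "HOL-Computational_Algebra.Primes"
    "HOL-Computational_Algebra.Fraction_Field"
begin

section \<open>The rings of p-adic integers\<close>

text \<open>The prime \<open>p\<close> is carried by a type parameter: \<open>p = CARD('p)\<close>.\<close>

class prime_cardinality =
  assumes prime_CARD: "prime CARD('a)"

text \<open>
  The inverse limit of the rings of integers modulo \<open>p ^ n\<close>; the \<open>n\<close>-th entry of a sequence
  is the representative in \<open>{0..<p ^ n}\<close> of the residue class modulo \<open>p ^ n\<close> (the range
  condition follows from the one in the definition).
\<close>

typedef (overloaded) 'p padic_int =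
  "{x :: nat \<Rightarrow> int. \<forall>n. x n = x (Suc n) mod int CARD('p::prime_cardinality) ^ n}"
  morphisms padic_residue Abs_padic_int
  by (rule exI[of _ "\<lambda>_. 0"]) simp

setup_lifting type_definition_padic_int

context
  fixes P :: int
begin

private lemma mod_step: "(a mod P ^ Suc n) mod P ^ n = a mod P ^ n"
  by (rule mod_mod_cancel) simp

private lemma add_step:
  assumes "x n = x (Suc n) mod P ^ n" "y n = y (Suc n) mod P ^ n"
  shows "(x n + y n) mod P ^ n = (x (Suc n) + y (Suc n)) mod P ^ Suc n mod P ^ n"
  unfolding mod_step using assms by (simp add: mod_add_eq)

private lemma diff_step:
  assumes "x n = x (Suc n) mod P ^ n" "y n = y (Suc n) mod P ^ n"
  shows "(x n - y n) mod P ^ n = (x (Suc n) - y (Suc n)) mod P ^ Suc n mod P ^ n"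
  unfolding mod_step using assms by (simp add: mod_diff_eq)

private lemma minus_step:
  assumes "x n = x (Suc n) mod P ^ n"
  shows "(- x n) mod P ^ n = (- x (Suc n)) mod P ^ Suc n mod P ^ n"
  unfolding mod_step using assms by (simp add: mod_minus_eq)

private lemma mult_step:
  assumes "x n = x (Suc n) mod P ^ n" "y n = y (Suc n) mod P ^ n"
  shows "(x n * y n) mod P ^ n = (x (Suc n) * y (Suc n)) mod P ^ Suc n mod P ^ n"
  unfolding mod_step using assms by (simp add: mod_mult_eq)

lemmas padic_int_steps = mod_step add_step diff_step minus_step mult_step

end

instantiation padic_int :: (prime_cardinality) comm_ring_1
begin

lift_definition zero_padic_int :: "'a padic_int" is "\<lambda>_. 0" by simp

lift_definition one_padic_int :: "'a padic_int" is "\<lambda>n. 1 mod int CARD('a) ^ n"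
  by (metis padic_int_steps(1))

lift_definition plus_padic_int :: "'a padic_int \<Rightarrow> 'a padic_int \<Rightarrow> 'a padic_int"
  is "\<lambda>x y n. (x n + y n) mod int CARD('a) ^ n"
  using padic_int_steps(2) by blast

lift_definition minus_padic_int :: "'a padic_int \<Rightarrow> 'a padic_int \<Rightarrow> 'a padic_int"
  is "\<lambda>x y n. (x n - y n) mod int CARD('a) ^ n"
  using padic_int_steps(3) by blast

lift_definition uminus_padic_int :: "'a padic_int \<Rightarrow> 'a padic_int"
  is "\<lambda>x n. (- x n) mod int CARD('a) ^ n"
  using padic_int_steps(4) by blast

lift_definition times_padic_int :: "'a padic_int \<Rightarrow> 'a padic_int \<Rightarrow> 'a padic_int"
  is "\<lambda>x y n. (x n * y n) mod int CARD('a) ^ n"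
  using padic_int_steps(5) by blast

instance
proof
  fix a b c :: "'a padic_int"
  have canonical: "x n mod int CARD('a) ^ n = x n"
    if "\<forall>n. x n = x (Suc n) mod int CARD('a) ^ n" for x :: "nat \<Rightarrow> int" and n
    using that by (metis mod_mod_trivial)
  show "a * b * c = a * (b * c)"
    by transfer (simp (no_asm) add: mod_mult_left_eq mod_mult_right_eq mult.assoc)
  show "a * b = b * a"
    by transfer (simp (no_asm) add: mult.commute)
  show "1 * a = a"
    by transfer (rule ext, simp (no_asm) only: mod_mult_left_eq mult_1, rule canonical)
  show "a + b + c = a + (b + c)"
    by transfer (simp (no_asm) add: mod_add_left_eq mod_add_right_eq add.assoc)
  show "a + b = b + a"
    by transfer (simp (no_asm) add: add.commute)
  show "0 + a = a"
    by transfer (rule ext, simp (no_asm) only: add_0, rule canonical)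
  show "- a + a = 0"
    by transfer (simp (no_asm) add: mod_add_left_eq)
  show "a - b = a + - b"
    by transfer (simp (no_asm) add: mod_add_right_eq)
  show "(a + b) * c = a * c + b * c"
    by transfer (simp (no_asm) add: mod_mult_left_eq mod_add_eq distrib_right)
  show "(0 :: 'a padic_int) \<noteq> 1"
  proof -
    have "1 < int CARD('a)"
      using prime_gt_1_nat[OF prime_CARD[where 'a='a]] by linarith
    then show ?thesis
      by transfer (auto simp: fun_eq_iff intro!: exI[of _ 1])
  qed
qed

end

lemma padic_residue_Suc:
  "padic_residue x n = padic_residue x (Suc n) mod int CARD('p) ^ n"
  for x :: "'p::prime_cardinality padic_int"
  using padic_residue[of x] unfolding mem_Collect_eq by (rule spec)

lemma padic_residue_mod_power:
  fixes x :: "'p::prime_cardinality padic_int"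
  assumes "m \<le> n"
  shows "padic_residue x n mod int CARD('p) ^ m = padic_residue x m"
  using assms
proof (induction n rule: dec_induct)
  case base
  show ?case by (subst (1 2) padic_residue_Suc) (simp only: mod_mod_trivial)
next
  case (step n)
  have "padic_residue x m = (padic_residue x (Suc n) mod int CARD('p) ^ n) mod int CARD('p) ^ m"
    by (simp only: step.IH flip: padic_residue_Suc)
  also have "\<dots> = padic_residue x (Suc n) mod int CARD('p) ^ m"
    using step.hyps by (intro mod_mod_cancel le_imp_power_dvd)
  finally show ?case by (rule sym)
qed

lemma padic_residue_eq_0_iff_dvd:
  fixes x :: "'p::prime_cardinality padic_int"
  assumes "m \<le> n"
  shows "padic_residue x m = 0 \<longleftrightarrow> int CARD('p) ^ m dvd padic_residue x n"
  unfolding padic_residue_mod_power[OF assms, symmetric] by (rule mod_eq_0_iff_dvd)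

lemma padic_residue_mult:
  fixes x y :: "'p::prime_cardinality padic_int"
  shows "padic_residue (x * y) n = (padic_residue x n * padic_residue y n) mod int CARD('p) ^ n"
  by (simp add: times_padic_int.rep_eq)

lemma padic_residue_add:
  fixes x y :: "'p::prime_cardinality padic_int"
  shows "padic_residue (x + y) n = (padic_residue x n + padic_residue y n) mod int CARD('p) ^ n"
  by (simp add: plus_padic_int.rep_eq)

lemma padic_residue_0 [simp]: "padic_residue 0 n = 0"
  by (simp add: zero_padic_int.rep_eq)

lemma padic_residue_0_right [simp]: "padic_residue x 0 = 0"
  using padic_residue_mod_power[of 0 0 x] by simp

lemma padic_int_eq_0_iff: "x = 0 \<longleftrightarrow> (\<forall>n. padic_residue x n = 0)"
  by (simp add: fun_eq_iff zero_padic_int.rep_eq flip: padic_residue_inject)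

lemma prime_int_CARD: "prime (int CARD('p::prime_cardinality))"
  using prime_CARD[where 'a='p] by simp

lemma padic_residue_mult_nonzero:
  fixes x y :: "'p::prime_cardinality padic_int"
  assumes "padic_residue x (Suc m) \<noteq> 0" "padic_residue y (Suc n) \<noteq> 0"
  shows "padic_residue (x * y) (Suc (m + n)) \<noteq> 0"
proof
  assume "padic_residue (x * y) (Suc (m + n)) = 0"
  then have "int CARD('p) ^ Suc (m + n) dvd padic_residue x (Suc (m + n)) * padic_residue y (Suc (m + n))"
    by (simp add: padic_residue_mult mod_eq_0_iff_dvd)
  moreover have "Suc m + Suc n = Suc (Suc (m + n))" by simp
  ultimately have "int CARD('p) ^ Suc m dvd padic_residue x (Suc (m + n)) \<or>
      int CARD('p) ^ Suc n dvd padic_residue y (Suc (m + n))"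
    using prime_int_CARD[where 'p='p] by (intro prime_elem_power_dvd_cases) auto
  then show False
    using assms padic_residue_eq_0_iff_dvd[of "Suc m" "Suc (m + n)" x]
      padic_residue_eq_0_iff_dvd[of "Suc n" "Suc (m + n)" y] by auto
qed

instance padic_int :: (prime_cardinality) idom
proof
  fix a b :: "'a padic_int"
  assume "a \<noteq> 0" "b \<noteq> 0"
  then obtain m n where "padic_residue a m \<noteq> 0" "padic_residue b n \<noteq> 0"
    by (auto simp: padic_int_eq_0_iff)
  moreover from this obtain m' n' where "m = Suc m'" "n = Suc n'"
    by (metis padic_residue_0_right not0_implies_Suc)
  ultimately show "a * b \<noteq> 0"
    using padic_residue_mult_nonzero[of a m' b n'] by auto
qed

lemma padic_residue_of_nat:
  "padic_residue (of_nat k :: 'p::prime_cardinality padic_int) n = int k mod int CARD('p) ^ n"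
proof (induction k)
  case (Suc k)
  have "padic_residue (1 :: 'p padic_int) n = 1 mod int CARD('p) ^ n"
    by (rule fun_cong[OF one_padic_int.rep_eq])
  then show ?case
    using Suc by (simp add: padic_residue_add mod_add_eq)
qed simp

instance padic_int :: (prime_cardinality) ring_char_0
proof
  show "inj (of_nat :: nat \<Rightarrow> 'a padic_int)"
  proof (rule injI)
    fix j k :: nat
    assume eq: "(of_nat j :: 'a padic_int) = of_nat k"
    define n where "n = max j k"
    have "1 < CARD('a)"
      using prime_gt_1_nat[OF prime_CARD[where 'a='a]] .
    then have "n < CARD('a) ^ n"
      by (simp add: power_gt_expt)
    then have "int n < int CARD('a) ^ n"
      by (metis of_nat_less_iff of_nat_power)
    then have "int j < int CARD('a) ^ n" "int k < int CARD('a) ^ n"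
      by (auto simp: n_def)
    moreover have "int j mod int CARD('a) ^ n = int k mod int CARD('a) ^ n"
      using arg_cong[OF eq, of "\<lambda>x. padic_residue x n"] by (simp only: padic_residue_of_nat)
    ultimately show "j = k" by simp
  qed
qed


section \<open>The fields of p-adic numbers\<close>

typedef (overloaded) 'p padic = "UNIV :: 'p::prime_cardinality padic_int fract set"
  morphisms fract_of_padic padic_of_fract ..

setup_lifting type_definition_padic

instantiation padic :: (prime_cardinality) field
begin

lift_definition zero_padic :: "'a padic" is 0 .
lift_definition one_padic :: "'a padic" is 1 .
lift_definition plus_padic :: "'a padic \<Rightarrow> 'a padic \<Rightarrow> 'a padic" is "(+)" .
lift_definition minus_padic :: "'a padic \<Rightarrow> 'a padic \<Rightarrow> 'a padic" is "(-)" .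
lift_definition uminus_padic :: "'a padic \<Rightarrow> 'a padic" is uminus .
lift_definition times_padic :: "'a padic \<Rightarrow> 'a padic \<Rightarrow> 'a padic" is "(*)" .
lift_definition inverse_padic :: "'a padic \<Rightarrow> 'a padic" is inverse .
lift_definition divide_padic :: "'a padic \<Rightarrow> 'a padic \<Rightarrow> 'a padic" is "(/)" .

instance
  by (standard; transfer) (simp_all add: algebra_simps divide_inverse)

end

definition of_padic_int :: "'p::prime_cardinality padic_int \<Rightarrow> 'p padic" where
  "of_padic_int a = padic_of_fract (Fraction_Field.Fract a 1)"

lemma of_padic_int_0 [simp]: "of_padic_int 0 = 0"
  and of_padic_int_1 [simp]: "of_padic_int 1 = 1"
  and of_padic_int_add: "of_padic_int (a + b) = of_padic_int a + of_padic_int b"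
  and of_padic_int_mult: "of_padic_int (a * b) = of_padic_int a * of_padic_int b"
  and of_padic_int_eq_iff [simp]: "of_padic_int a = of_padic_int b \<longleftrightarrow> a = b"
  by (simp_all add: of_padic_int_def zero_padic_def one_padic_def plus_padic.abs_eq
    times_padic.abs_eq padic_of_fract_inject Zero_fract_def One_fract_def eq_fract)

lemma of_padic_int_of_nat [simp]: "of_padic_int (of_nat n) = of_nat n"
  by (induction n) (simp_all add: of_padic_int_add)

instance padic :: (prime_cardinality) field_char_0
proof
  show "inj (of_nat :: nat \<Rightarrow> 'a padic)"
    by (rule injI) (metis of_padic_int_of_nat of_padic_int_eq_iff of_nat_eq_iff)
qed

lemma padic_cases:
  fixes x :: "'p::prime_cardinality padic"
  obtains a b where "b \<noteq> 0" "x = padic_of_fract (Fraction_Field.Fract a b)"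
  by (metis Fract_cases padic_of_fract_cases)


section \<open>Valuation and topology\<close>

text \<open>Only meaningful for nonzero arguments, like \<open>padic_val\<close> below.\<close>

definition padic_int_val :: "'p::prime_cardinality padic_int \<Rightarrow> nat" where
  "padic_int_val x = (LEAST n. padic_residue x (Suc n) \<noteq> 0)"

lemma padic_residue_eq_0_iff_val:
  fixes x :: "'p::prime_cardinality padic_int"
  assumes "x \<noteq> 0"
  shows "padic_residue x n = 0 \<longleftrightarrow> n \<le> padic_int_val x"
proof -
  obtain m where "padic_residue x m \<noteq> 0"
    using assms by (auto simp: padic_int_eq_0_iff)
  then obtain m' where "padic_residue x (Suc m') \<noteq> 0"
    by (metis padic_residue_0_right not0_implies_Suc)
  then have *: "padic_residue x (Suc (padic_int_val x)) \<noteq> 0"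
    unfolding padic_int_val_def by (rule LeastI)
  show ?thesis
  proof
    assume "padic_residue x n = 0"
    then have "\<not> Suc (padic_int_val x) \<le> n"
      using * padic_residue_mod_power[of "Suc (padic_int_val x)" n x] by auto
    then show "n \<le> padic_int_val x" by simp
  next
    assume "n \<le> padic_int_val x"
    then show "padic_residue x n = 0"
    proof (cases n)
      case (Suc k)
      with \<open>n \<le> padic_int_val x\<close> have "k < padic_int_val x" by simp
      then show ?thesis
        unfolding padic_int_val_def Suc by (metis not_less_Least)
    qed simp
  qed
qed

lemma padic_int_val_mult:
  fixes x y :: "'p::prime_cardinality padic_int"
  assumes "x \<noteq> 0" "y \<noteq> 0"
  shows "padic_int_val (x * y) = padic_int_val x + padic_int_val y"
proof -
  let ?m = "padic_int_val x" and ?n = "padic_int_val y"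
  have nz: "x * y \<noteq> 0" using assms by simp
  have "padic_residue (x * y) (Suc (?m + ?n)) \<noteq> 0"
    by (rule padic_residue_mult_nonzero) (simp_all add: padic_residue_eq_0_iff_val assms)
  then have "padic_int_val (x * y) \<le> ?m + ?n"
    using padic_residue_eq_0_iff_val[OF nz] by (metis not_less_eq_eq)
  moreover have "int CARD('p) ^ ?m dvd padic_residue x (?m + ?n)"
      "int CARD('p) ^ ?n dvd padic_residue y (?m + ?n)"
    using assms by (simp_all add: padic_residue_eq_0_iff_val flip: padic_residue_eq_0_iff_dvd)
  then have "padic_residue (x * y) (?m + ?n) = 0"
    by (simp add: padic_residue_mult mod_eq_0_iff_dvd mult_dvd_mono power_add)
  then have "?m + ?n \<le> padic_int_val (x * y)"
    using padic_residue_eq_0_iff_val[OF nz] by blast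
  ultimately show ?thesis by simp
qed

lemma padic_int_val_add:
  fixes x y :: "'p::prime_cardinality padic_int"
  assumes "x \<noteq> 0" "y \<noteq> 0" "x + y \<noteq> 0"
  shows "min (padic_int_val x) (padic_int_val y) \<le> padic_int_val (x + y)"
proof -
  let ?m = "min (padic_int_val x) (padic_int_val y)"
  have "padic_residue x ?m = 0" "padic_residue y ?m = 0"
    using assms by (simp_all add: padic_residue_eq_0_iff_val)
  then have "padic_residue (x + y) ?m = 0"
    by (simp add: padic_residue_add)
  then show ?thesis
    using padic_residue_eq_0_iff_val[OF assms(3)] by blast
qed

lift_definition fract_val :: "'p::prime_cardinality padic_int fract \<Rightarrow> int"
  is "\<lambda>(a, b). if a = 0 then 0 else int (padic_int_val a) - int (padic_int_val b)"
proof -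
  fix r s :: "'p padic_int \<times> 'p padic_int"
  assume "fractrel r s"
  then have h: "snd r \<noteq> 0" "snd s \<noteq> 0" "fst r * snd s = fst s * snd r"
    by (auto simp: fractrel_def)
  then have z: "fst r = 0 \<longleftrightarrow> fst s = 0" by auto
  moreover have "int (padic_int_val (fst r)) - int (padic_int_val (snd r)) =
      int (padic_int_val (fst s)) - int (padic_int_val (snd s))" if "fst r \<noteq> 0"
  proof -
    have "padic_int_val (fst r) + padic_int_val (snd s) =
        padic_int_val (fst s) + padic_int_val (snd r)"
      using h z that by (metis padic_int_val_mult)
    then show ?thesis by linarith
  qed
  ultimately show "(case r of (a, b) \<Rightarrow>
        if a = 0 then 0 else int (padic_int_val a) - int (padic_int_val b)) =
      (case s of (a, b) \<Rightarrow>
        if a = 0 then 0 else int (padic_int_val a) - int (padic_int_val b))"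
    by (simp add: case_prod_beta)
qed

lift_definition padic_val :: "'p::prime_cardinality padic \<Rightarrow> int" is fract_val .

lemma padic_val_Fract:
  assumes "a \<noteq> 0" "b \<noteq> 0"
  shows "padic_val (padic_of_fract (Fraction_Field.Fract a b)) =
    int (padic_int_val a) - int (padic_int_val b)"
proof -
  have "fract_val (Fraction_Field.Fract a b) = int (padic_int_val a) - int (padic_int_val b)"
    using assms by transfer auto
  then show ?thesis
    by (simp add: padic_val.rep_eq padic_of_fract_inverse)
qed

definition padic_norm :: "'p::prime_cardinality padic \<Rightarrow> real" where
  "padic_norm x = (if x = 0 then 0 else real CARD('p) powi (- padic_val x))"

lemma padic_of_fract_eq_0_iff:
  assumes "b \<noteq> 0"
  shows "padic_of_fract (Fraction_Field.Fract a b) = 0 \<longleftrightarrow> a = 0"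
  using assms by (simp add: zero_padic_def padic_of_fract_inject Zero_fract_def eq_fract)

lemma padic_val_uminus: "padic_val (- x) = padic_val x"
proof -
  have *: "padic_int_val (- a) = padic_int_val a" for a :: "'a padic_int"
  proof -
    have "padic_residue (- a) n = 0 \<longleftrightarrow> padic_residue a n = 0" for n
    proof -
      have "padic_residue (- a) n = 0 \<longleftrightarrow> int CARD('a) ^ n dvd padic_residue a n"
        by (simp add: uminus_padic_int.rep_eq mod_eq_0_iff_dvd)
      then show ?thesis
        by (simp only: padic_residue_eq_0_iff_dvd[OF order.refl])
    qed
    then show ?thesis by (simp add: padic_int_val_def)
  qed
  have "fract_val (- y) = fract_val y" for y :: "'a padic_int fract"
    by transfer (auto simp: *)
  then show ?thesis by transfer
qed

lemma padic_val_add: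
  fixes x y :: "'p::prime_cardinality padic"
  assumes "x \<noteq> 0" "y \<noteq> 0" "x + y \<noteq> 0"
  shows "min (padic_val x) (padic_val y) \<le> padic_val (x + y)"
proof -
  obtain a b where x: "b \<noteq> 0" "x = padic_of_fract (Fraction_Field.Fract a b)"
    by (rule padic_cases)
  obtain c d where y: "d \<noteq> 0" "y = padic_of_fract (Fraction_Field.Fract c d)"
    by (rule padic_cases)
  have x': "x = padic_of_fract (Fraction_Field.Fract (a * d) (b * d))"
    using x(1) y(1) by (simp add: x(2) padic_of_fract_inject eq_fract)
  have y': "y = padic_of_fract (Fraction_Field.Fract (c * b) (b * d))"
    using x(1) y(1) by (simp add: y(2) padic_of_fract_inject eq_fract)
  have s: "x + y = padic_of_fract (Fraction_Field.Fract (a * d + c * b) (b * d))"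
    unfolding x(2) y(2) using x(1) y(1) by (simp add: plus_padic.abs_eq)
  have bd: "b * d \<noteq> 0" using x(1) y(1) by simp
  have nz: "a * d \<noteq> 0" "c * b \<noteq> 0" "a * d + c * b \<noteq> 0"
    using assms padic_of_fract_eq_0_iff[OF bd] x' y' s by auto
  have "min (padic_int_val (a * d)) (padic_int_val (c * b)) \<le> padic_int_val (a * d + c * b)"
    using nz by (rule padic_int_val_add)
  then show ?thesis
    unfolding s unfolding x' y' unfolding padic_val_Fract[OF nz(1) bd]
      padic_val_Fract[OF nz(2) bd] padic_val_Fract[OF nz(3) bd] by linarith
qed

lemma padic_norm_nonneg: "0 \<le> padic_norm x"
  by (simp add: padic_norm_def)

lemma padic_norm_eq_0_iff: "padic_norm x = 0 \<longleftrightarrow> x = 0"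
  for x :: "'p::prime_cardinality padic"
proof -
  have "0 < CARD('p)" using prime_gt_0_nat[OF prime_CARD[where 'a='p]] .
  then show ?thesis by (simp add: padic_norm_def)
qed

lemma padic_norm_uminus: "padic_norm (- x) = padic_norm x"
proof -
  have "- x = 0 \<longleftrightarrow> x = 0" by (rule neg_equal_0_iff_equal)
  then show ?thesis by (simp add: padic_norm_def padic_val_uminus)
qed

lemma padic_norm_add_le_max: "padic_norm (x + y) \<le> max (padic_norm x) (padic_norm y)"
  for x y :: "'p::prime_cardinality padic"
proof (cases "x = 0 \<or> y = 0 \<or> x + y = 0")
  case True
  then show ?thesis
    using padic_norm_nonneg[of x] by (auto simp: padic_norm_def le_max_iff_disj)
next
  case False
  have p: "1 \<le> real CARD('p)"
    using prime_gt_1_nat[OF prime_CARD[where 'a='p]] by linarith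
  have "padic_val x \<le> padic_val (x + y) \<or> padic_val y \<le> padic_val (x + y)"
    using padic_val_add[of x y] False by linarith
  then show ?thesis
    using False power_int_increasing[OF _ p]
    by (auto simp: padic_norm_def le_max_iff_disj)
qed

instantiation padic :: (prime_cardinality) metric_space
begin

definition dist_padic :: "'a padic \<Rightarrow> 'a padic \<Rightarrow> real" where
  "dist_padic x y = padic_norm (x - y)"

definition uniformity_padic :: "('a padic \<times> 'a padic) filter" where
  "uniformity_padic = (INF e\<in>{0<..}. principal {(x, y). dist x y < e})"

definition open_padic :: "'a padic set \<Rightarrow> bool" where
  "open_padic U \<longleftrightarrow> (\<forall>x\<in>U. \<forall>\<^sub>F (x', y) in uniformity. x' = x \<longrightarrow> y \<in> U)"

instance
proof
  fix x y z :: "'a padic"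
  show "dist x y = 0 \<longleftrightarrow> x = y"
    by (simp add: dist_padic_def padic_norm_eq_0_iff)
  have "padic_norm ((x - z) + - (y - z)) \<le> max (padic_norm (x - z)) (padic_norm (y - z))"
    using padic_norm_add_le_max padic_norm_uminus by metis
  then show "dist x y \<le> dist x z + dist y z"
    using padic_norm_nonneg[of "x - z"] padic_norm_nonneg[of "y - z"]
    by (simp add: dist_padic_def)
qed (simp_all add: uniformity_padic_def open_padic_def)

end

definition analytic_Zp :: "('p::prime_cardinality padic_int \<Rightarrow> 'p padic) \<Rightarrow> bool" where
  "analytic_Zp f \<longleftrightarrow> (\<exists>c. \<forall>x. (\<lambda>n. c n * of_padic_int x ^ n) sums f x)"

definition roots_Zp :: "('p::prime_cardinality padic_int \<Rightarrow> 'p padic) \<Rightarrow> 'p padic_int set" where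
  "roots_Zp f = {x. f x = 0}"

definition nu :: "nat \<Rightarrow> 'p::prime_cardinality padic \<Rightarrow> int extended" where
  "nu l x = (if x = 0 then Pinf else Fin \<lfloor>real_of_int (padic_val x) / real l\<rfloor>)"

text \<open>
  The integer sequences obtained from the values of \<open>nu l (f n)\<close> by replacing the terms
  \<open>Pinf\<close> by arbitrary integers.
\<close>

definition nu_sequence ::
  "nat \<Rightarrow> ('p::prime_cardinality padic_int \<Rightarrow> 'p padic) \<Rightarrow> (nat \<Rightarrow> int) \<Rightarrow> bool" where
  "nu_sequence l f a \<longleftrightarrow>
    (\<forall>n. nu l (f (of_nat n)) \<noteq> Pinf \<longrightarrow> nu l (f (of_nat n)) = Fin (a n))"


section \<open>Periodic and regular sequences of integers\<close>

definition has_period :: "(nat \<Rightarrow> 'a) \<Rightarrow> nat \<Rightarrow> bool" where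
  "has_period a T \<longleftrightarrow> 0 < T \<and> (\<forall>n. a (n + T) = a n)"

definition periodic :: "(nat \<Rightarrow> 'a) \<Rightarrow> bool" where
  "periodic a \<longleftrightarrow> (\<exists>T. has_period a T)"

definition k_kernel :: "nat \<Rightarrow> (nat \<Rightarrow> 'a) \<Rightarrow> (nat \<Rightarrow> 'a) set" where
  "k_kernel k a = {(\<lambda>n. a (k ^ i * n + j)) | i j. j \<le> k ^ i - 1}"

definition scale_seq :: "int \<Rightarrow> (nat \<Rightarrow> int) \<Rightarrow> (nat \<Rightarrow> int)" where
  "scale_seq c a = (\<lambda>n. c * a n)"

interpretation int_seq: module scale_seq
  by standard (simp_all add: scale_seq_def fun_eq_iff algebra_simps)

definition k_regular :: "nat \<Rightarrow> (nat \<Rightarrow> int) \<Rightarrow> bool" where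
  "k_regular k a \<longleftrightarrow>
    (\<exists>F. finite F \<and> int_seq.span F = int_seq.span (k_kernel k a))"

definition regular :: "(nat \<Rightarrow> int) \<Rightarrow> bool" where
  "regular a \<longleftrightarrow> (\<exists>k\<ge>2. k_regular k a)"

definition mult_independent :: "nat \<Rightarrow> nat \<Rightarrow> bool" where
  "mult_independent k m \<longleftrightarrow> (\<forall>a\<ge>1. \<forall>c\<ge>1. k ^ a \<noteq> m ^ c)"

definition strictly_k_regular :: "nat \<Rightarrow> (nat \<Rightarrow> int) \<Rightarrow> bool" where
  "strictly_k_regular k a \<longleftrightarrow>
    k_regular k a \<and> (\<forall>m\<ge>2. mult_independent k m \<longrightarrow> \<not> k_regular m a)"

end

theory Submission
  imports Defs
begin

text \<open>
  Near a point \<open>r\<close> one has \<open>\<bar>f x\<bar> = \<bar>x - r\<bar> ^ m * \<bar>b\<bar>\<close> with \<open>b \<noteq> 0\<close> (divide the power series by \<open>x - r\<close>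
  as long as \<open>r\<close> is a root; Strassmann's argument bounds the number of divisions), so by compactness the
  terms \<open>a n\<close> on a residue class modulo \<open>p ^ e\<close> are either constant or of the form
  \<open>(m * v(n - r) + c) div l\<close> with \<open>r\<close> a root. Without roots, \<open>p ^ e\<close> is a period. If \<open>r = u / w\<close> is
  rational and \<open>j\<close> is close to \<open>r\<close>, then \<open>w * (p ^ i * n + j - r) = p ^ i * (w * n + Q)\<close> with an integer
  \<open>Q\<close> that is bounded independently of \<open>i\<close> and \<open>j\<close>, so up to constants only finitely many kernel
  sequences occur.

  Conversely, let \<open>a\<close> be \<open>k\<close>-regular and \<open>r\<close> a root. If \<open>k\<close> is not a power of \<open>p\<close>, consider the multiples
  of \<open>p ^ e\<close>. The elements of the span of the kernel are determined there by their values on a finite set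
  \<open>S\<close>. For \<open>N \<notin> S\<close> and large \<open>i\<close> there are two indices \<open>j < k ^ i\<close> such that \<open>k ^ i * N + j\<close> is very close
  to \<open>r\<close>, at two different distances; the two kernel sequences agree on \<open>S\<close> but not at \<open>N\<close>, a
  contradiction. If \<open>k = p ^ s\<close> and \<open>r\<close> is irrational, take \<open>j i < k ^ i\<close> with \<open>j i\<close> congruent to \<open>r\<close> modulo
  \<open>k ^ i\<close>. The kernel sequence at \<open>(i, j i)\<close> has its singularity at \<open>(r - j i) / k ^ i\<close>; these points
  are pairwise distinct, so no such sequence is a combination of finitely many others. But a submodule
  of a finitely generated abelian group is finitely generated.
\<close>

section \<open>Residues and valuations of p-adic integers\<close>

lemma padic_residue_diff:
  "padic_residue (x - y) n = (padic_residue x n - padic_residue y n) mod int CARD('p) ^ n"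
  for x y :: "'p::prime_cardinality padic_int"
  by (simp add: minus_padic_int.rep_eq)

lemma padic_residue_mod_self [simp]:
  "padic_residue x n mod int CARD('p) ^ n = padic_residue x n"
  for x :: "'p::prime_cardinality padic_int"
  by (rule padic_residue_mod_power) simp

lemma padic_residue_bounds:
  fixes x :: "'p::prime_cardinality padic_int"
  shows "0 \<le> padic_residue x n" "padic_residue x n < int CARD('p) ^ n"
proof -
  have "0 < int CARD('p)"
    using prime_gt_0_nat[OF prime_CARD[where 'a='p]] by simp
  then have "0 < int CARD('p) ^ n" by (rule zero_less_power)
  then show "0 \<le> padic_residue x n" "padic_residue x n < int CARD('p) ^ n"
    by (metis padic_residue_mod_self pos_mod_sign, metis padic_residue_mod_self pos_mod_bound)
qed

lemma padic_residue_eq_iff_diff: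
  "padic_residue x n = padic_residue y n \<longleftrightarrow> padic_residue (x - y) n = 0"
  for x y :: "'p::prime_cardinality padic_int"
  by (metis padic_residue_diff padic_residue_mod_self mod_eq_dvd_iff mod_eq_0_iff_dvd)

lemma padic_residue_eq_mono:
  fixes x y :: "'p::prime_cardinality padic_int"
  assumes "padic_residue x n = padic_residue y n" "m \<le> n"
  shows "padic_residue x m = padic_residue y m"
  using assms by (metis padic_residue_mod_power)

lemma padic_residue_eq_iff_val:
  fixes x y :: "'p::prime_cardinality padic_int"
  assumes "x \<noteq> y"
  shows "padic_residue x n = padic_residue y n \<longleftrightarrow> n \<le> padic_int_val (x - y)"
  using assms by (simp add: padic_residue_eq_iff_diff padic_residue_eq_0_iff_val)

lemma padic_residue_of_int:
  "padic_residue (of_int z :: 'p::prime_cardinality padic_int) n = z mod int CARD('p) ^ n"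
proof (cases z)
  case (nonneg k)
  then show ?thesis by (simp add: padic_residue_of_nat)
next
  case (neg k)
  have "(of_int z :: 'p padic_int) = 0 - of_nat (Suc k)"
    by (simp add: neg)
  then have "padic_residue (of_int z :: 'p padic_int) n = (0 - int (Suc k)) mod int CARD('p) ^ n"
    by (simp only: padic_residue_diff padic_residue_of_nat padic_residue_0 mod_diff_right_eq)
  then show ?thesis by (simp add: neg)
qed

lemma padic_residue_mult_eq_0:
  fixes x y :: "'p::prime_cardinality padic_int"
  assumes "padic_residue x n = 0"
  shows "padic_residue (x * y) n = 0"
  using assms by (simp add: padic_residue_mult)

lemma padic_int_val_1 [simp]: "padic_int_val (1 :: 'p::prime_cardinality padic_int) = 0"
  using padic_int_val_mult[of "1 :: 'p padic_int" 1] by simp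

lemma padic_int_val_power:
  fixes x :: "'p::prime_cardinality padic_int"
  assumes "x \<noteq> 0"
  shows "padic_int_val (x ^ n) = n * padic_int_val x"
  by (induction n) (simp_all add: assms padic_int_val_mult)

text \<open>\<open>y\<close> is divisible by a higher power of p than \<open>x\<close>, so it does
  not change the residues that decide the valuation. Using a residue of \<open>y\<close> instead of
  its valuation covers \<open>y = 0\<close>.\<close>

lemma padic_int_val_add_dominant:
  fixes x y :: "'p::prime_cardinality padic_int"
  assumes "x \<noteq> 0" "padic_residue y (Suc (padic_int_val x)) = 0"
  shows "x + y \<noteq> 0" "padic_int_val (x + y) = padic_int_val x"
proof -
  have eq: "padic_residue (x + y) n = padic_residue x n" if "n \<le> Suc (padic_int_val x)" for n
    using padic_residue_eq_mono[of y _ 0, OF _ that] assms(2)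
    by (simp add: padic_residue_eq_iff_diff)
  have "padic_residue (x + y) (Suc (padic_int_val x)) \<noteq> 0"
    using eq[OF order.refl] padic_residue_eq_0_iff_val[OF assms(1)] by simp
  moreover from this show nz: "x + y \<noteq> 0" by auto
  moreover have "padic_residue (x + y) (padic_int_val x) = 0"
    using eq[of "padic_int_val x"] padic_residue_eq_0_iff_val[OF assms(1)] by simp
  ultimately show "padic_int_val (x + y) = padic_int_val x"
    using padic_residue_eq_0_iff_val[OF nz] by (metis le_antisym not_less_eq_eq)
qed

lemma padic_int_val_CARD_power:
  "padic_int_val (of_nat CARD('p) ^ n :: 'p::prime_cardinality padic_int) = n"
proof -
  have nz: "(of_nat CARD('p) :: 'p padic_int) \<noteq> 0"
    using prime_gt_0_nat[OF prime_CARD[where 'a='p]] by simp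
  have p1: "1 < int CARD('p)"
    using prime_gt_1_nat[OF prime_CARD[where 'a='p]] by simp
  have "padic_residue (of_nat CARD('p) :: 'p padic_int) 1 = 0"
    by (simp add: padic_residue_of_nat)
  then have "1 \<le> padic_int_val (of_nat CARD('p) :: 'p padic_int)"
    using padic_residue_eq_0_iff_val[OF nz] by blast
  moreover have "padic_residue (of_nat CARD('p) :: 'p padic_int) (Suc 1) \<noteq> 0"
    using p1 by (simp add: padic_residue_of_nat power2_eq_square)
  then have "padic_int_val (of_nat CARD('p) :: 'p padic_int) \<le> 1"
    using padic_residue_eq_0_iff_val[OF nz] by (metis not_less_eq_eq)
  ultimately have "padic_int_val (of_nat CARD('p) :: 'p padic_int) = 1" by simp
  then show ?thesis by (simp add: padic_int_val_power[OF nz])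
qed

lemma padic_int_val_of_nat_eq_0:
  assumes "\<not> CARD('p) dvd k"
  shows "padic_int_val (of_nat k :: 'p::prime_cardinality padic_int) = 0"
proof -
  have "padic_residue (of_nat k :: 'p padic_int) (Suc 0) \<noteq> 0"
    using assms by (simp add: padic_residue_of_nat mod_eq_0_iff_dvd)
  then show ?thesis
    unfolding padic_int_val_def by (simp add: Least_equality)
qed

section \<open>Approximation by natural numbers, and compactness\<close>

lemma ex_nat_padic_residue:
  fixes x :: "'p::prime_cardinality padic_int"
  shows "\<exists>j < CARD('p) ^ n. padic_residue (of_nat j :: 'p padic_int) n = padic_residue x n"
proof (intro exI conjI)
  show "nat (padic_residue x n) < CARD('p) ^ n"
    using padic_residue_bounds[of x n] by (simp add: nat_less_iff)
  show "padic_residue (of_nat (nat (padic_residue x n)) :: 'p padic_int) n = padic_residue x n"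
    using padic_residue_bounds[of x n] by (simp add: padic_residue_of_int)
qed

text \<open>A representative of \<open>x + p ^ n\<close> modulo \<open>p ^ Suc n\<close> differs
  from \<open>x\<close> by exact valuation \<open>n\<close>. The bound on \<open>j\<close> serves to
  keep it below \<open>k ^ i\<close> in the non-regularity argument.\<close>

lemma ex_nat_padic_int_val:
  fixes x :: "'p::prime_cardinality padic_int"
  shows "\<exists>j < CARD('p) ^ Suc n. of_nat j \<noteq> x \<and> padic_int_val (of_nat j - x) = n"
proof -
  let ?q = "of_nat CARD('p) ^ n :: 'p padic_int"
  have nz: "?q \<noteq> 0"
    using prime_gt_0_nat[OF prime_CARD[where 'a='p]] by simp
  obtain j where j: "j < CARD('p) ^ Suc n"
    "padic_residue (of_nat j :: 'p padic_int) (Suc n) = padic_residue (x + ?q) (Suc n)"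
    using ex_nat_padic_residue by blast
  have "padic_residue (of_nat j - (x + ?q)) (Suc (padic_int_val ?q)) = 0"
    using j(2) unfolding padic_int_val_CARD_power padic_residue_eq_iff_diff .
  from padic_int_val_add_dominant[OF nz this]
  have "of_nat j - x \<noteq> 0" "padic_int_val (of_nat j - x) = n"
    by (simp_all add: padic_int_val_CARD_power)
  then show ?thesis using j(1) by auto
qed

text \<open>Compactness of Z_p by a Koenig-style descent: if no \<open>n\<close> served all points,
  nested residue classes without a common bound would shrink to a point \<open>r\<close>, against
  \<open>local\<close> at \<open>r\<close>.\<close>

lemma padic_int_uniform:
  fixes Q :: "nat \<Rightarrow> 'p::prime_cardinality padic_int \<Rightarrow> bool"
  assumes mono: "\<And>x y m n. Q m x \<Longrightarrow> m \<le> n \<Longrightarrow> padic_residue y m = padic_residue x m \<Longrightarrow> Q n y"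
    and local: "\<And>x. \<exists>n. Q n x"
  shows "\<exists>n. \<forall>x. Q n x"
proof (rule ccontr)
  assume contra: "\<not> ?thesis"
  \<comment> \<open>\<open>bad n z\<close>: no single \<open>N\<close> serves the whole class of
    \<open>z\<close> modulo \<open>p ^ n\<close>.\<close>
  define bad where "bad n z \<longleftrightarrow> (\<forall>N. \<exists>x. padic_residue x n = padic_residue z n \<and> \<not> Q N x)"
    for n and z :: "'p padic_int"
  have step: "\<exists>z'. bad (Suc n) z' \<and> padic_residue z' n = padic_residue z n" if "bad n z" for n and z :: "'p padic_int"
  proof (rule ccontr)
    assume "\<not> ?thesis"
    then have *: "\<exists>N. \<forall>x. padic_residue x (Suc n) = padic_residue z' (Suc n) \<longrightarrow> Q N x"
      if "padic_residue z' n = padic_residue z n" for z' :: "'p padic_int"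
      using that unfolding bad_def by blast
    have "\<exists>N. \<forall>x :: 'p padic_int. padic_residue x (Suc n) = \<rho> \<and> padic_residue x n = padic_residue z n
        \<longrightarrow> Q N x" for \<rho>
    proof (cases "\<exists>z' :: 'p padic_int. padic_residue z' n = padic_residue z n \<and> padic_residue z' (Suc n) = \<rho>")
      case True
      then obtain z' :: "'p padic_int" where z': "padic_residue z' n = padic_residue z n" "padic_residue z' (Suc n) = \<rho>"
        by blast
      then show ?thesis using *[OF z'(1)] by auto
    qed auto
    then have "\<exists>N. \<forall>\<rho> (x :: 'p padic_int). padic_residue x (Suc n) = \<rho> \<and> padic_residue x n = padic_residue z n
        \<longrightarrow> Q (N \<rho>) x"
      by (intro choice allI)
    then obtain N where N: "Q (N \<rho>) x"
      if "padic_residue x (Suc n) = \<rho>" "padic_residue x n = padic_residue z n" for \<rho> x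
      by blast
    \<comment> \<open>Only finitely many residues occur, so the largest of their bounds serves the
      whole class.\<close>
    define M where "M = Max (N ` {0..<int CARD('p) ^ Suc n})"
    have "Q M x" if "padic_residue x n = padic_residue z n" for x
    proof -
      have "N (padic_residue x (Suc n)) \<le> M"
        unfolding M_def using padic_residue_bounds[of x "Suc n"] by (intro Max_ge) auto
      then show ?thesis using mono[OF N[OF refl that]] by blast
    qed
    with \<open>bad n z\<close> show False unfolding bad_def by blast
  qed
  have "bad 0 0" using contra unfolding bad_def by auto
  then obtain z where bad: "\<And>n. bad n (z n)"
    and z: "\<And>n. padic_residue (z (Suc n)) n = padic_residue (z n) n"
    using dependent_nat_choice[of bad "\<lambda>n x y. padic_residue y n = padic_residue x n"] step
    by metis
  define r :: "'p padic_int" where "r = Abs_padic_int (\<lambda>n. padic_residue (z n) n)"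
  have r: "padic_residue r n = padic_residue (z n) n" for n
    unfolding r_def using z by (subst Abs_padic_int_inverse) (auto simp flip: padic_residue_Suc)
  obtain n where "Q n r" using local by blast
  moreover obtain x where "padic_residue x n = padic_residue (z n) n" "\<not> Q n x"
    using bad unfolding bad_def by blast
  ultimately show False using mono[of n r n x] r by simp
qed

section \<open>The p-adic norm\<close>

lemma CARD_gt_1: "1 < real CARD('p::prime_cardinality)"
  using prime_gt_1_nat[OF prime_CARD[where 'a='p]] by simp

lemma padic_val_mult:
  fixes x y :: "'p::prime_cardinality padic"
  assumes "x \<noteq> 0" "y \<noteq> 0"
  shows "padic_val (x * y) = padic_val x + padic_val y"
proof -
  obtain a b where x: "b \<noteq> 0" "x = padic_of_fract (Fraction_Field.Fract a b)"
    by (rule padic_cases)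
  obtain c d where y: "d \<noteq> 0" "y = padic_of_fract (Fraction_Field.Fract c d)"
    by (rule padic_cases)
  have "a \<noteq> 0" "c \<noteq> 0"
    using assms x y padic_of_fract_eq_0_iff by auto
  moreover have "x * y = padic_of_fract (Fraction_Field.Fract (a * c) (b * d))"
    by (simp add: x y times_padic.abs_eq)
  ultimately show ?thesis
    using x y by (simp add: padic_val_Fract padic_int_val_mult)
qed

lemma padic_norm_mult: "padic_norm (x * y) = padic_norm x * padic_norm y"
  for x y :: "'p::prime_cardinality padic"
  using CARD_gt_1[where 'p='p]
  by (auto simp: padic_norm_def padic_val_mult power_int_diff power_int_minus divide_inverse
    simp flip: power_int_add)

declare padic_norm_nonneg [simp]

lemma abs_padic_norm [simp]: "\<bar>padic_norm x\<bar> = padic_norm x"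
  by simp

lemma padic_norm_0 [simp]: "padic_norm 0 = 0"
  by (simp add: padic_norm_def)

lemma padic_norm_1 [simp]: "padic_norm (1 :: 'p::prime_cardinality padic) = 1"
  using padic_norm_mult[of "1 :: 'p padic" 1] padic_norm_eq_0_iff[of "1 :: 'p padic"] by simp

lemma padic_norm_power: "padic_norm (x ^ n) = padic_norm x ^ n"
  for x :: "'p::prime_cardinality padic"
  by (induction n) (simp_all add: padic_norm_mult)

lemma padic_norm_pos: "x \<noteq> 0 \<Longrightarrow> 0 < padic_norm x"
  for x :: "'p::prime_cardinality padic"
  using padic_norm_nonneg[of x] padic_norm_eq_0_iff[of x] by linarith

lemma padic_norm_eq_iff_val:
  fixes x y :: "'p::prime_cardinality padic"
  assumes "x \<noteq> 0" "y \<noteq> 0"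
  shows "padic_norm x = padic_norm y \<longleftrightarrow> padic_val x = padic_val y"
proof -
  have "inj (\<lambda>k. real CARD('p) powi k)"
    using CARD_gt_1[where 'p='p]
    by (intro strict_mono_imp_inj_on strict_monoI power_int_strict_increasing) auto
  then have "real CARD('p) powi k = real CARD('p) powi l \<longleftrightarrow> k = l" for k l
    by (rule inj_eq)
  then show ?thesis using assms by (simp add: padic_norm_def)
qed

lemma padic_norm_diff_le_max: "padic_norm (x - y) \<le> max (padic_norm x) (padic_norm y)"
  for x y :: "'p::prime_cardinality padic"
  using padic_norm_add_le_max[of x "- y"] by (simp add: padic_norm_uminus)

lemma padic_norm_minus_commute: "padic_norm (x - y) = padic_norm (y - x)"
  for x y :: "'p::prime_cardinality padic"
  using padic_norm_uminus[of "x - y"] by simp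

lemma padic_norm_add_eq:
  fixes x y :: "'p::prime_cardinality padic"
  assumes "padic_norm y < padic_norm x"
  shows "padic_norm (x + y) = padic_norm x"
  using assms padic_norm_add_le_max[of x y] padic_norm_diff_le_max[of "x + y" y] by simp

lemma padic_norm_eq_of_diff_less:
  fixes x y :: "'p::prime_cardinality padic"
  assumes "padic_norm (x - y) < padic_norm y"
  shows "padic_norm x = padic_norm y"
  using padic_norm_add_eq[of "x - y" y] assms by simp

lemma padic_norm_sum_le:
  fixes u :: "'b \<Rightarrow> 'p::prime_cardinality padic"
  assumes "0 \<le> B" "\<And>i. i \<in> A \<Longrightarrow> padic_norm (u i) \<le> B"
  shows "padic_norm (sum u A) \<le> B"
  using assms(2)
proof (induction A rule: infinite_finite_induct)
  case (insert i A)
  then show ?case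
    using padic_norm_add_le_max[of "u i" "sum u A"] by (simp add: order_trans)
qed (use assms(1) in simp_all)

lemma of_padic_int_diff:
  "of_padic_int (a - b) = of_padic_int a - of_padic_int b"
  using of_padic_int_add[of "a - b" b] by simp

lemma of_padic_int_power: "of_padic_int (a ^ n) = of_padic_int a ^ n"
  by (induction n) (simp_all add: of_padic_int_mult)

lemma of_padic_int_of_int: "of_padic_int (of_int z) = of_int z"
proof (cases z)
  case (neg k)
  have "of_padic_int (0 - of_nat (Suc k)) = 0 - of_nat (Suc k)"
    by (simp only: of_padic_int_diff of_padic_int_of_nat of_padic_int_0)
  then show ?thesis by (simp add: neg)
qed simp

lemma of_padic_int_eq_0_iff [simp]: "of_padic_int a = 0 \<longleftrightarrow> a = 0"
  using of_padic_int_eq_iff[of a 0] by simp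

lemma padic_val_of_padic_int:
  "x \<noteq> 0 \<Longrightarrow> padic_val (of_padic_int x) = int (padic_int_val x)"
  unfolding of_padic_int_def by (subst padic_val_Fract) simp_all

lemma padic_norm_of_padic_int:
  fixes x :: "'p::prime_cardinality padic_int"
  assumes "x \<noteq> 0"
  shows "padic_norm (of_padic_int x) = (1 / real CARD('p)) ^ padic_int_val x"
  using assms by (simp add: padic_norm_def padic_val_of_padic_int power_int_minus power_divide
    inverse_eq_divide)

lemma padic_norm_of_padic_int_le_1: "padic_norm (of_padic_int x) \<le> 1"
  for x :: "'p::prime_cardinality padic_int"
  using CARD_gt_1[where 'p='p]
  by (cases "x = 0") (simp_all add: padic_norm_of_padic_int power_le_one)

lemma padic_norm_of_padic_int_diff_le:
  fixes x y :: "'p::prime_cardinality padic_int"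
  assumes "padic_residue x n = padic_residue y n"
  shows "padic_norm (of_padic_int x - of_padic_int y) \<le> (1 / real CARD('p)) ^ n"
proof (cases "x = y")
  case False
  then show ?thesis
    using assms CARD_gt_1[where 'p='p]
    by (simp add: padic_norm_of_padic_int padic_residue_eq_iff_val power_decreasing
      flip: of_padic_int_diff)
qed (use CARD_gt_1[where 'p='p] in simp)

text \<open>By the ultrametric inequality, a term \<open>S n\<close> that is nearer to
  \<open>L\<close> than \<open>A\<close> is cannot lie in the ball around \<open>A\<close> unless
  \<open>L\<close> does.\<close>

lemma padic_norm_limit_le:
  fixes S :: "nat \<Rightarrow> 'p::prime_cardinality padic"
  assumes lim: "S \<longlonglongrightarrow> L" and "0 \<le> B" and le: "\<forall>\<^sub>F n in sequentially. padic_norm (S n - A) \<le> B"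
  shows "padic_norm (L - A) \<le> B"
proof (rule ccontr)
  assume "\<not> ?thesis"
  then have gt: "B < padic_norm (L - A)" by simp
  then have "\<forall>\<^sub>F n in sequentially. dist (S n) L < padic_norm (L - A)"
    using assms(2) by (intro tendstoD[OF lim]) simp
  from eventually_happens'[OF _ eventually_conj[OF this le]] obtain n
    where n: "padic_norm (S n - L) < padic_norm (L - A)" "padic_norm (S n - A) \<le> B"
    by (auto simp: dist_padic_def)
  have "padic_norm (S n - A - (S n - L)) \<le> max (padic_norm (S n - A)) (padic_norm (S n - L))"
    by (rule padic_norm_diff_le_max)
  then show False using n gt by (simp add: le_max_iff_disj)
qed


section \<open>Power series over the p-adic integers\<close>

lemma power_series_coeffs_tendsto_0:
  fixes c :: "nat \<Rightarrow> 'p::prime_cardinality padic"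
  assumes "c sums s"
  shows "(\<lambda>n. padic_norm (c n)) \<longlonglongrightarrow> 0"
proof (rule LIMSEQ_I)
  fix e :: real assume "0 < e"
  then obtain M where M: "\<And>n. n \<ge> M \<Longrightarrow> padic_norm ((\<Sum>i<n. c i) - s) < e"
    using assms unfolding sums_def lim_sequentially dist_padic_def by meson
  have "padic_norm (c n) < e" if "n \<ge> M" for n
  proof -
    have "padic_norm (((\<Sum>i<Suc n. c i) - s) - ((\<Sum>i<n. c i) - s)) < e"
      using that by (intro le_less_trans[OF padic_norm_diff_le_max]) (simp add: M del: sum.lessThan_Suc)
    then show ?thesis by simp
  qed
  then show "\<exists>M. \<forall>n\<ge>M. norm (padic_norm (c n) - 0) < e"
    by (intro exI[of _ M]) auto
qed

text \<open>Only finitely many coefficients are at least as large as \<open>c n0\<close>, so the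
  maximum is attained and has a last index. This is the index in Strassmann's bound on the number of
  roots.\<close>

lemma ex_last_maximal_norm:
  fixes c :: "nat \<Rightarrow> 'p::prime_cardinality padic"
  assumes lim: "(\<lambda>n. padic_norm (c n)) \<longlonglongrightarrow> 0" and "c n0 \<noteq> 0"
  shows "\<exists>N. c N \<noteq> 0 \<and> (\<forall>n. padic_norm (c n) \<le> padic_norm (c N)) \<and>
    (\<forall>n>N. padic_norm (c n) < padic_norm (c N))"
proof -
  have pos: "0 < padic_norm (c n0)" using assms(2) by (rule padic_norm_pos)
  define A where "A = {n. padic_norm (c n0) \<le> padic_norm (c n)}"
  obtain M where M: "\<And>n. n \<ge> M \<Longrightarrow> padic_norm (c n) < padic_norm (c n0)"
    using LIMSEQ_D[OF lim pos] by auto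
  have fin: "finite A"
    by (rule finite_subset[of _ "{..<M}"]) (use M in \<open>auto simp: A_def not_le[symmetric]\<close>)
  have n0: "n0 \<in> A" by (simp add: A_def)
  define B where "B = Max ((\<lambda>n. padic_norm (c n)) ` A)"
  have B: "padic_norm (c n) \<le> B" if "n \<in> A" for n
    unfolding B_def using that fin by simp
  have "B \<in> (\<lambda>n. padic_norm (c n)) ` A"
    unfolding B_def using fin n0 by (intro Max_in) auto
  define N where "N = Max {n \<in> A. padic_norm (c n) = B}"
  have N: "N \<in> {n \<in> A. padic_norm (c n) = B}"
    unfolding N_def using fin \<open>B \<in> _\<close> by (intro Max_in) auto
  have NB: "padic_norm (c N) = B" using N by simp
  have le: "padic_norm (c n) \<le> B" for n
    using B[of n] B[OF n0] by (cases "n \<in> A") (auto simp: A_def)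
  have less: "padic_norm (c n) < B" if "n > N" for n
  proof (rule ccontr)
    assume "\<not> ?thesis"
    then have eq: "padic_norm (c n) = B" using le[of n] by simp
    then have "n \<in> A" using B[OF n0] by (simp add: A_def)
    then have "n \<le> N" unfolding N_def using eq fin by (intro Max_ge) auto
    then show False using that by simp
  qed
  have "c N \<noteq> 0" using NB B[OF n0] pos by auto
  then show ?thesis using le less NB by auto
qed

text \<open>Synthetic division: \<open>g\<close> lists the coefficients of the quotient by
  \<open>x - r\<close>. Each \<open>g j\<close> is a tail of the series in disguise, so the
  ultrametric inequality bounds it by the later coefficients.\<close>

lemma power_series_divide_root:
  fixes c :: "nat \<Rightarrow> 'p::prime_cardinality padic" and r :: "'p padic"
  assumes lim: "(\<lambda>n. padic_norm (c n)) \<longlonglongrightarrow> 0"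
    and r: "padic_norm r \<le> 1" "(\<lambda>n. c n * r ^ n) sums 0"
  obtains g where "c 0 = - (r * g 0)" "\<forall>j. c (Suc j) = g j - r * g (Suc j)"
    "\<forall>j B. 0 \<le> B \<longrightarrow> (\<forall>n>j. padic_norm (c n) \<le> B) \<longrightarrow> padic_norm (g j) \<le> B"
proof (cases "r = 0")
  \<comment> \<open>The general formula for \<open>g\<close> divides by powers of \<open>r\<close>;
    here the quotient is the shifted sequence.\<close>
  case True
  have "(\<lambda>n. \<Sum>i<n. c i * r ^ i) \<longlonglongrightarrow> c 0"
  proof (rule tendsto_eventually, rule eventually_sequentiallyI)
    fix n :: nat assume "1 \<le> n"
    have "(\<Sum>i<n. c i * r ^ i) = (\<Sum>i\<in>{0}. c i * r ^ i)"
      using \<open>1 \<le> n\<close> by (intro sum.mono_neutral_right) (auto simp: True)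
    then show "(\<Sum>i<n. c i * r ^ i) = c 0" by simp
  qed
  then have "c 0 = 0"
    using r(2) LIMSEQ_unique unfolding sums_def by blast
  then show ?thesis by (intro that[of "\<lambda>j. c (Suc j)"]) (simp_all add: True)
next
  case False
  \<comment> \<open>\<open>g j\<close> is the tail sum \<open>\<Sum>n>j. c n * r ^ (n - j - 1)\<close>, written as a finite sum so that no
    completeness is needed.\<close>
  define g where "g j = - (\<Sum>n\<le>j. c n * r ^ n) / r ^ Suc j" for j
  show ?thesis
  proof (rule that[of g])
    show "c 0 = - (r * g 0)" using False by (simp add: g_def)
    show "\<forall>j. c (Suc j) = g j - r * g (Suc j)"
      using False by (simp add: g_def field_simps)
    have "padic_norm (g j) \<le> B" if B: "0 \<le> B" "\<And>n. n > j \<Longrightarrow> padic_norm (c n) \<le> B" for j B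
    proof -
      let ?A = "\<Sum>n\<le>j. c n * r ^ n" and ?\<rho> = "padic_norm r ^ Suc j"
      \<comment> \<open>As the full series sums to 0, \<open>0 - ?A\<close> is the limit of the sums
        over indices above \<open>j\<close>, each term of which is at most
        \<open>B * ?\<rho>\<close> because \<open>r\<close> lies in the unit ball.\<close>
      have "padic_norm (0 - ?A) \<le> B * ?\<rho>"
      proof (rule padic_norm_limit_le)
        show "(\<lambda>n. \<Sum>i<n. c i * r ^ i) \<longlonglongrightarrow> 0" using r(2) by (simp add: sums_def)
        show "0 \<le> B * ?\<rho>" using B(1) by simp
        show "\<forall>\<^sub>F n in sequentially. padic_norm ((\<Sum>i<n. c i * r ^ i) - ?A) \<le> B * ?\<rho>"
        proof (rule eventually_sequentiallyI)
          fix n assume "Suc j \<le> n"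
          then have "(\<Sum>i<n. c i * r ^ i) - ?A = (\<Sum>i\<in>{..<n} - {..j}. c i * r ^ i)"
            by (subst sum_diff) auto
          also have "padic_norm \<dots> \<le> B * ?\<rho>"
          proof (rule padic_norm_sum_le)
            fix i assume "i \<in> {..<n} - {..j}"
            then show "padic_norm (c i * r ^ i) \<le> B * ?\<rho>"
              unfolding padic_norm_mult padic_norm_power
              using B r(1) by (intro mult_mono power_decreasing) auto
          qed (use B(1) in simp)
          finally show "padic_norm ((\<Sum>i<n. c i * r ^ i) - ?A) \<le> B * ?\<rho>" .
        qed
      qed
      moreover have "?A = - (g j * r ^ Suc j)" using False by (simp add: g_def)
      ultimately have "padic_norm (g j) * ?\<rho> \<le> B * ?\<rho>"
        by (simp add: padic_norm_mult padic_norm_power)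
      then show ?thesis
        using padic_norm_pos[OF False] by (simp add: mult_le_cancel_right)
    qed
    then show "\<forall>j B. 0 \<le> B \<longrightarrow> (\<forall>n>j. padic_norm (c n) \<le> B) \<longrightarrow> padic_norm (g j) \<le> B"
      by blast
  qed
qed

lemma padic_norm_power_diff_le:
  fixes x y :: "'p::prime_cardinality padic"
  assumes "padic_norm x \<le> 1" "padic_norm y \<le> 1"
  shows "padic_norm (x ^ n - y ^ n) \<le> padic_norm (x - y)"
proof (induction n)
  case (Suc n)
  have "x ^ Suc n - y ^ Suc n = x * (x ^ n - y ^ n) + (x - y) * y ^ n"
    by (simp add: algebra_simps)
  moreover have "padic_norm (x * (x ^ n - y ^ n)) \<le> padic_norm (x - y)"
    using mult_mono[OF assms(1) Suc] by (simp add: padic_norm_mult)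
  moreover have "padic_norm ((x - y) * y ^ n) \<le> padic_norm (x - y)"
    unfolding padic_norm_mult padic_norm_power
    by (intro mult_left_le power_le_one padic_norm_nonneg assms)
  ultimately show ?case
    using padic_norm_add_le_max[of "x * (x ^ n - y ^ n)" "(x - y) * y ^ n"] by simp
qed simp

text \<open>At \<open>r\<close> the partial sums do not tend to 0 while the terms do, so a late
  partial sum that is not small fixes the norm of all later ones. Partial sums vary little with
  \<open>x\<close>, uniformly in their length, which carries the norm over to nearby points and then
  to the limit.\<close>

lemma power_series_norm_constant_near_nonroot:
  fixes c :: "nat \<Rightarrow> 'p::prime_cardinality padic" and r :: "'p padic_int"
  assumes lim: "(\<lambda>n. padic_norm (c n)) \<longlonglongrightarrow> 0" and C: "\<And>n. padic_norm (c n) \<le> C"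
    and nonroot: "\<not> (\<lambda>n. c n * of_padic_int r ^ n) sums 0"
  obtains b :: "'p padic" and e where "b \<noteq> 0"
    "\<forall>x s. padic_residue x e = padic_residue r e \<longrightarrow>
      (\<lambda>n. c n * of_padic_int x ^ n) sums s \<longrightarrow> padic_norm s = padic_norm b"
proof -
  define S where "S x M = (\<Sum>n<M. c n * of_padic_int x ^ n)" for x M
  obtain \<epsilon> where \<epsilon>: "0 < \<epsilon>" "\<And>M0. \<exists>M\<ge>M0. \<epsilon> \<le> padic_norm (S r M)"
    using nonroot unfolding sums_def S_def[symmetric] lim_sequentially dist_padic_def
    by (force simp: not_less)
  obtain M0 where M0: "\<And>n. n \<ge> M0 \<Longrightarrow> padic_norm (c n) < \<epsilon>"
    using LIMSEQ_D[OF lim \<epsilon>(1)] by auto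
  obtain M where M: "M0 \<le> M" "\<epsilon> \<le> padic_norm (S r M)" using \<epsilon>(2) by blast
  define b where "b = S r M"
  have b: "0 < padic_norm b" using M(2) \<epsilon>(1) by (simp add: b_def)
  have S_r: "padic_norm (S r M') = padic_norm b" if "M \<le> M'" for M'
    using that
  proof (induction M' rule: dec_induct)
    case (step M')
    have "padic_norm (c M' * of_padic_int r ^ M') \<le> padic_norm (c M')"
      unfolding padic_norm_mult padic_norm_power
      by (intro mult_left_le power_le_one padic_norm_nonneg padic_norm_of_padic_int_le_1)
    also have "\<dots> < padic_norm (S r M')"
      using M0[of M'] M step by (simp add: b_def)
    finally have "padic_norm (S r M' + c M' * of_padic_int r ^ M') = padic_norm (S r M')"
      by (rule padic_norm_add_eq)
    then show ?case using step.IH by (simp add: S_def)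
  qed (simp add: b_def)
  have C0: "0 \<le> C" using C[of 0] padic_norm_nonneg[of "c 0"] by linarith
  \<comment> \<open>\<open>e\<close> makes the Lipschitz estimate smaller than the norm of
    \<open>b\<close>; \<open>C + 1\<close> replaces \<open>C\<close> to allow division.\<close>
  obtain e where e: "(C + 1) * (1 / real CARD('p)) ^ e < padic_norm b"
  proof -
    obtain e where "(1 / real CARD('p)) ^ e < padic_norm b / (C + 1)"
      using real_arch_pow_inv[of "padic_norm b / (C + 1)" "1 / real CARD('p)"] b C0
        CARD_gt_1[where 'p='p] by auto
    then show ?thesis using that C0 by (simp add: field_simps)
  qed
  have near: "padic_norm s = padic_norm b"
    if x: "padic_residue x e = padic_residue r e"
      and s: "(\<lambda>n. c n * of_padic_int x ^ n) sums s" for x s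
  proof -
    have "padic_norm (S x M' - S r M') \<le> (C + 1) * (1 / real CARD('p)) ^ e" for M'
    proof -
      have "padic_norm (\<Sum>n<M'. c n * (of_padic_int x ^ n - of_padic_int r ^ n))
          \<le> (C + 1) * (1 / real CARD('p)) ^ e"
      proof (rule padic_norm_sum_le)
        fix n
        have "padic_norm (of_padic_int x ^ n - of_padic_int r ^ n) \<le> (1 / real CARD('p)) ^ e"
          using padic_norm_power_diff_le[OF padic_norm_of_padic_int_le_1 padic_norm_of_padic_int_le_1]
            padic_norm_of_padic_int_diff_le[OF x] order_trans by blast
        then show "padic_norm (c n * (of_padic_int x ^ n - of_padic_int r ^ n))
            \<le> (C + 1) * (1 / real CARD('p)) ^ e"
          unfolding padic_norm_mult using C[of n] C0
          by (intro mult_mono) auto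
      qed (use C0 in simp)
      then show ?thesis by (simp add: S_def sum_subtractf right_diff_distrib)
    qed
    then have S_x: "padic_norm (S x M') = padic_norm b" if "M \<le> M'" for M'
      using padic_norm_eq_of_diff_less[of "S x M'" "S r M'"] S_r[OF that] e
      by (metis le_less_trans)
    obtain M1 where M1: "\<And>n. n \<ge> M1 \<Longrightarrow> dist (S x n) s < padic_norm b"
      using s b unfolding sums_def S_def[symmetric] lim_sequentially by meson
    have "padic_norm (s - S x (max M M1)) < padic_norm (S x (max M M1))"
      using M1[of "max M M1"] S_x[of "max M M1"]
      by (simp add: dist_padic_def padic_norm_minus_commute)
    then show ?thesis using padic_norm_eq_of_diff_less S_x[of "max M M1"] by fastforce
  qed
  show ?thesis
  proof (rule that[of b e])
    show "b \<noteq> 0" using b by auto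
  qed (use near in blast)
qed

text \<open>By telescoping, the partial sums of \<open>c\<close> are those of \<open>g\<close> times
  \<open>x - r\<close>, up to the boundary term \<open>r * g M * x ^ M\<close>, which tends to
  0.\<close>

lemma power_series_quotient_sums:
  fixes c g :: "nat \<Rightarrow> 'p::prime_cardinality padic"
  assumes c: "c 0 = - (r * g 0)" "\<And>j. c (Suc j) = g j - r * g (Suc j)"
    and lim: "(\<lambda>n. padic_norm (g n)) \<longlonglongrightarrow> 0"
    and le_1: "padic_norm r \<le> 1" "padic_norm x \<le> 1" and "x \<noteq> r"
    and s: "(\<lambda>n. c n * x ^ n) sums s"
  shows "(\<lambda>n. g n * x ^ n) sums (s / (x - r))"
  unfolding sums_def
proof (rule metric_LIMSEQ_I)
  let ?\<delta> = "padic_norm (x - r)"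
  fix \<epsilon> :: real assume "0 < \<epsilon>"
  have \<delta>: "0 < ?\<delta>" using \<open>x \<noteq> r\<close> by (simp add: padic_norm_pos)
  then have pos: "0 < \<epsilon> * ?\<delta>" using \<open>0 < \<epsilon>\<close> by simp
  have partial: "(\<Sum>n<Suc M. c n * x ^ n) = (x - r) * (\<Sum>n<M. g n * x ^ n) - r * g M * x ^ M" for M
  proof (induction M)
    case (Suc M)
    have "(\<Sum>n<Suc (Suc M). c n * x ^ n) = (\<Sum>n<Suc M. c n * x ^ n) + c (Suc M) * x ^ Suc M"
      by simp
    then show ?case unfolding Suc c(2) by (simp add: algebra_simps)
  qed (simp add: c(1))
  obtain M1 where M1: "\<And>n. n \<ge> M1 \<Longrightarrow> padic_norm ((\<Sum>i<n. c i * x ^ i) - s) < \<epsilon> * ?\<delta>"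
    using metric_LIMSEQ_D[OF s[unfolded sums_def] pos] unfolding dist_padic_def by blast
  obtain M2 where M2: "\<And>n. n \<ge> M2 \<Longrightarrow> padic_norm (g n) < \<epsilon> * ?\<delta>"
    using LIMSEQ_D[OF lim pos] by auto
  have "padic_norm ((\<Sum>i<n. g i * x ^ i) - s / (x - r)) < \<epsilon>" if n: "n \<ge> max M1 M2" for n
  proof -
    have "padic_norm (r * g n * x ^ n) \<le> 1 * padic_norm (g n) * 1"
      unfolding padic_norm_mult padic_norm_power
      by (intro mult_mono mult_nonneg_nonneg padic_norm_nonneg power_le_one le_1 order.refl
        zero_le_power zero_le_one)
    then have 2: "padic_norm (r * g n * x ^ n) < \<epsilon> * ?\<delta>"
      using M2[of n] n by simp
    have 1: "padic_norm ((\<Sum>i<Suc n. c i * x ^ i) - s) < \<epsilon> * ?\<delta>"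
      using M1[of "Suc n"] n by simp
    have "(x - r) * ((\<Sum>i<n. g i * x ^ i) - s / (x - r)) =
        ((\<Sum>i<Suc n. c i * x ^ i) - s) + r * g n * x ^ n"
      using \<open>x \<noteq> r\<close> unfolding partial by (simp add: right_diff_distrib)
    then have "?\<delta> * padic_norm ((\<Sum>i<n. g i * x ^ i) - s / (x - r)) =
        padic_norm (((\<Sum>i<Suc n. c i * x ^ i) - s) + r * g n * x ^ n)"
      by (simp only: flip: padic_norm_mult)
    also have "\<dots> < \<epsilon> * ?\<delta>"
      by (rule le_less_trans[OF padic_norm_add_le_max]) (use 1 2 in simp)
    finally show ?thesis using \<delta> by (simp add: mult.commute)
  qed
  then show "\<exists>M. \<forall>n\<ge>M. dist (\<Sum>i<n. g i * x ^ i) (s / (x - r)) < \<epsilon>"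
    unfolding dist_padic_def by blast
qed

text \<open>Norms of nonzero elements are integral powers of p. The gained factor keeps a bound
  strict when it is passed on to the tail sums \<open>g j\<close>.\<close>

lemma padic_norm_less_imp_le:
  fixes x y :: "'p::prime_cardinality padic"
  assumes "padic_norm x < padic_norm y"
  shows "padic_norm x \<le> padic_norm y / real CARD('p)"
proof (cases "x = 0")
  case False
  have y: "y \<noteq> 0" using assms by (metis padic_norm_0 padic_norm_nonneg not_less)
  have "- padic_val x < - padic_val y"
  proof (rule ccontr)
    assume "\<not> ?thesis"
    then have "padic_norm y \<le> padic_norm x"
      using False y CARD_gt_1[where 'p='p] by (simp add: padic_norm_def power_int_increasing)
    then show False using assms by simp
  qed
  then have "real CARD('p) powi (- padic_val x) \<le> real CARD('p) powi (- padic_val y - 1)"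
    using CARD_gt_1[where 'p='p] by (intro power_int_increasing) auto
  then show ?thesis
    using False y CARD_gt_1[where 'p='p] by (simp add: padic_norm_def power_int_diff)
qed simp

text \<open>
  Induction on the index \<open>N\<close> of the last coefficient of maximal norm: dividing by a root
  lowers it by one, so roots can be divided out at most \<open>N\<close> times.
\<close>

lemma power_series_norm_local:
  fixes c :: "nat \<Rightarrow> 'p::prime_cardinality padic" and r :: "'p padic_int"
  assumes "(\<lambda>n. padic_norm (c n)) \<longlonglongrightarrow> 0" "c N \<noteq> 0"
    and "\<And>n. padic_norm (c n) \<le> padic_norm (c N)"
    and "\<And>n. N < n \<Longrightarrow> padic_norm (c n) < padic_norm (c N)"
  shows "\<exists>m b e. b \<noteq> 0 \<and> (m = 0 \<longleftrightarrow> \<not> (\<lambda>n. c n * of_padic_int r ^ n) sums 0) \<and>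
    (\<forall>x s. (x = r \<longrightarrow> m = 0) \<longrightarrow> padic_residue x e = padic_residue r e \<longrightarrow>
      (\<lambda>n. c n * of_padic_int x ^ n) sums s \<longrightarrow>
      padic_norm s = padic_norm (of_padic_int (x - r) ^ m * b))"
  using assms
proof (induction N arbitrary: c)
  case (0 c)
  \<comment> \<open>Base case: all later coefficients are strictly smaller than \<open>c 0\<close>,
    so a root would make \<open>g 0\<close> smaller too, although \<open>c 0\<close> is
    \<open>g 0\<close> times an element of norm at most 1.\<close>
  have nonroot: "\<not> (\<lambda>n. c n * of_padic_int r ^ n) sums 0"
  proof
    assume root: "(\<lambda>n. c n * of_padic_int r ^ n) sums 0"
    obtain g where
      c0: "c 0 = - (of_padic_int r * g 0)" "\<forall>j. c (Suc j) = g j - of_padic_int r * g (Suc j)" and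
      g: "\<forall>j B. 0 \<le> B \<longrightarrow> (\<forall>n>j. padic_norm (c n) \<le> B) \<longrightarrow> padic_norm (g j) \<le> B"
      by (rule power_series_divide_root[OF 0(1) padic_norm_of_padic_int_le_1 root])
    have "padic_norm (g 0) \<le> padic_norm (c 0) / real CARD('p)"
      using 0(4) by (intro g[rule_format] padic_norm_less_imp_le) simp_all
    also have "\<dots> < padic_norm (c 0)"
      using padic_norm_pos[OF 0(2)] CARD_gt_1[where 'p='p] by (simp add: divide_less_eq)
    finally have "padic_norm (of_padic_int r) * padic_norm (g 0) < padic_norm (c 0)"
      using mult_right_mono[OF padic_norm_of_padic_int_le_1[of r], of "padic_norm (g 0)"] by simp
    then show False by (simp add: c0(1) padic_norm_uminus padic_norm_mult)
  qed
  obtain b :: "'p padic" and e where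
    "b \<noteq> 0" "\<forall>x s. padic_residue x e = padic_residue r e \<longrightarrow>
      (\<lambda>n. c n * of_padic_int x ^ n) sums s \<longrightarrow> padic_norm s = padic_norm b"
    by (rule power_series_norm_constant_near_nonroot[OF 0(1,3) nonroot])
  note be = this
  show ?case
    by (rule exI[of _ 0], rule exI[of _ b], rule exI[of _ e])
      (use nonroot be in \<open>unfold power_0 mult_1_left, blast\<close>)
next
  case (Suc N c)
  show ?case
  proof (cases "(\<lambda>n. c n * of_padic_int r ^ n) sums 0")
    case False
    obtain b :: "'p padic" and e where
      "b \<noteq> 0" "\<forall>x s. padic_residue x e = padic_residue r e \<longrightarrow>
        (\<lambda>n. c n * of_padic_int x ^ n) sums s \<longrightarrow> padic_norm s = padic_norm b"
      by (rule power_series_norm_constant_near_nonroot[OF Suc.prems(1,3) False])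
    note be = this
    show ?thesis
      by (rule exI[of _ 0], rule exI[of _ b], rule exI[of _ e])
        (use False be in \<open>unfold power_0 mult_1_left, blast\<close>)
  next
    case True
    obtain g where
      c: "c 0 = - (of_padic_int r * g 0)" "\<forall>j. c (Suc j) = g j - of_padic_int r * g (Suc j)" and
      g: "\<forall>j B. 0 \<le> B \<longrightarrow> (\<forall>n>j. padic_norm (c n) \<le> B) \<longrightarrow> padic_norm (g j) \<le> B"
      by (rule power_series_divide_root[OF Suc.prems(1) padic_norm_of_padic_int_le_1 True])
    have pos: "0 < padic_norm (c (Suc N))" by (rule padic_norm_pos) fact
    have less: "padic_norm (g j) < padic_norm (c (Suc N))" if "j > N" for j
    proof -
      have "padic_norm (g j) \<le> padic_norm (c (Suc N)) / real CARD('p)"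
        using Suc.prems(4) that by (intro g[rule_format] padic_norm_less_imp_le) simp_all
      also have "\<dots> < padic_norm (c (Suc N))"
        using pos CARD_gt_1[where 'p='p] by (simp add: divide_less_eq)
      finally show ?thesis .
    qed
    have "padic_norm (of_padic_int r * g (Suc N)) < padic_norm (c (Suc N))"
      using less[of "Suc N"] mult_right_mono[OF padic_norm_of_padic_int_le_1[of r], of "padic_norm (g (Suc N))"]
      by (simp add: padic_norm_mult)
    \<comment> \<open>In \<open>g N = c (Suc N) + r * g (Suc N)\<close> the second term is strictly
      smaller, so the maximal norm is unchanged and its last index drops to
      \<open>N\<close>.\<close>
    then have gN: "padic_norm (g N) = padic_norm (c (Suc N))"
      using padic_norm_add_eq[of "of_padic_int r * g (Suc N)" "c (Suc N)"] c(2)[rule_format, of N] by simp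
    have lim: "(\<lambda>n. padic_norm (g n)) \<longlonglongrightarrow> 0"
    proof (rule LIMSEQ_I)
      fix \<epsilon> :: real assume "0 < \<epsilon>"
      then obtain M where M: "\<And>n. n \<ge> M \<Longrightarrow> padic_norm (c n) < \<epsilon> / 2"
        using LIMSEQ_D[OF Suc.prems(1), of "\<epsilon> / 2"] by auto
      have "padic_norm (g n) < \<epsilon>" if "n \<ge> M" for n
      proof -
        have "padic_norm (g n) \<le> \<epsilon> / 2"
          using M that \<open>0 < \<epsilon>\<close> by (intro g[rule_format] less_imp_le) simp_all
        then show ?thesis using \<open>0 < \<epsilon>\<close> by simp
      qed
      then show "\<exists>M. \<forall>n\<ge>M. norm (padic_norm (g n) - 0) < \<epsilon>" by auto
    qed
    have g0: "g N \<noteq> 0" using gN pos by auto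
    have gle: "padic_norm (g n) \<le> padic_norm (g N)" for n
      unfolding gN by (rule g[rule_format]) (use pos Suc.prems(3) in auto)
    have gless: "padic_norm (g n) < padic_norm (g N)" if "N < n" for n
      using less[OF that] by (simp add: gN)
    have "\<exists>m b e. b \<noteq> 0 \<and> (m = 0 \<longleftrightarrow> \<not> (\<lambda>n. g n * of_padic_int r ^ n) sums 0) \<and>
      (\<forall>x s. (x = r \<longrightarrow> m = 0) \<longrightarrow> padic_residue x e = padic_residue r e \<longrightarrow>
        (\<lambda>n. g n * of_padic_int x ^ n) sums s \<longrightarrow>
        padic_norm s = padic_norm (of_padic_int (x - r) ^ m * b))"
      by (rule Suc.IH[OF lim g0 gle]) (rule gless)
    then obtain m b e where b: "b \<noteq> 0"
      and IH: "\<forall>x s. (x = r \<longrightarrow> m = 0) \<longrightarrow> padic_residue x e = padic_residue r e \<longrightarrow>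
        (\<lambda>n. g n * of_padic_int x ^ n) sums s \<longrightarrow>
        padic_norm s = padic_norm (of_padic_int (x - r) ^ m * b)"
      by (elim exE conjE) (rule that)
    \<comment> \<open>The premise \<open>x = r \<longrightarrow> Suc m = 0\<close> excludes
      \<open>x = r\<close>, so the quotient series has the value \<open>s\<close> divided by
      \<open>x - r\<close>, which accounts for the one additional factor.\<close>
    have "padic_norm s = padic_norm (of_padic_int (x - r) ^ Suc m * b)"
      if "x = r \<longrightarrow> Suc m = 0" "padic_residue x e = padic_residue r e" "(\<lambda>n. c n * of_padic_int x ^ n) sums s" for x s
    proof -
      let ?d = "of_padic_int x - of_padic_int r"
      have "x \<noteq> r" using that(1) by auto
      have "(\<lambda>n. g n * of_padic_int x ^ n) sums (s / ?d)"
        by (rule power_series_quotient_sums[OF c(1) c(2)[rule_format] lim])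
          (use that(3) \<open>x \<noteq> r\<close> in \<open>simp_all add: padic_norm_of_padic_int_le_1\<close>)
      from IH[rule_format, OF _ that(2) this] \<open>x \<noteq> r\<close>
      have "padic_norm ?d * padic_norm (s / ?d) = padic_norm (of_padic_int (x - r) ^ Suc m * b)"
        by (simp add: padic_norm_mult of_padic_int_diff)
      then show ?thesis using \<open>x \<noteq> r\<close> by (simp flip: padic_norm_mult)
    qed
    note quotient = this
    show ?thesis
    proof (rule exI[of _ "Suc m"], rule exI[of _ b], rule exI[of _ e], intro conjI allI impI)
      show "Suc m = 0 \<longleftrightarrow> \<not> (\<lambda>n. c n * of_padic_int r ^ n) sums 0" using True by simp
    qed (rule b, rule quotient)
  qed
qed

section \<open>The valuation of an analytic function\<close>

text \<open>The norm formula in terms of valuations; \<open>m\<close> is the multiplicity of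
  \<open>r\<close> as a root. The guard \<open>x = r \<longrightarrow> m = 0\<close> admits the
  point \<open>r\<close> itself exactly when it is no root.\<close>

lemma analytic_Zp_valuation_local:
  fixes f :: "'p::prime_cardinality padic_int \<Rightarrow> 'p padic"
  assumes "analytic_Zp f" "\<exists>x. f x \<noteq> 0"
  shows "\<exists>m v e. (m = 0 \<longleftrightarrow> f r \<noteq> 0) \<and> (\<forall>x. (x = r \<longrightarrow> m = 0) \<longrightarrow> padic_residue x e = padic_residue r e \<longrightarrow>
    f x \<noteq> 0 \<and> padic_val (f x) = int m * int (padic_int_val (x - r)) + v)"
proof -
  obtain c where c: "\<And>x. (\<lambda>n. c n * of_padic_int x ^ n) sums f x"
    using assms(1) unfolding analytic_Zp_def by auto
  have "c sums f 1" using c[of 1] by simp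
  then have lim: "(\<lambda>n. padic_norm (c n)) \<longlonglongrightarrow> 0"
    by (rule power_series_coeffs_tendsto_0)
  have "\<exists>n. c n \<noteq> 0"
  proof (rule ccontr)
    assume "\<not> ?thesis"
    then have "(\<lambda>n. 0) sums f x" for x using c[of x] by simp
    then show False using assms(2) sums_unique2 sums_zero by metis
  qed
  then obtain n0 where "c n0 \<noteq> 0" by blast
  from ex_last_maximal_norm[OF lim this] obtain N where N: "c N \<noteq> 0"
    "\<forall>n. padic_norm (c n) \<le> padic_norm (c N)" "\<forall>n>N. padic_norm (c n) < padic_norm (c N)"
    by (elim exE conjE) (rule that)
  have "\<exists>m b e. b \<noteq> 0 \<and> (m = 0 \<longleftrightarrow> \<not> (\<lambda>n. c n * of_padic_int r ^ n) sums 0) \<and>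
    (\<forall>x s. (x = r \<longrightarrow> m = 0) \<longrightarrow> padic_residue x e = padic_residue r e \<longrightarrow>
      (\<lambda>n. c n * of_padic_int x ^ n) sums s \<longrightarrow>
      padic_norm s = padic_norm (of_padic_int (x - r) ^ m * b))"
    by (rule power_series_norm_local[OF lim N(1)]) (use N in blast)+
  then obtain m b e where b: "b \<noteq> 0"
    and m: "m = 0 \<longleftrightarrow> \<not> (\<lambda>n. c n * of_padic_int r ^ n) sums 0"
    and near: "\<forall>x s. (x = r \<longrightarrow> m = 0) \<longrightarrow> padic_residue x e = padic_residue r e \<longrightarrow>
      (\<lambda>n. c n * of_padic_int x ^ n) sums s \<longrightarrow>
      padic_norm s = padic_norm (of_padic_int (x - r) ^ m * b)"
    by (elim exE conjE) (rule that)
  have "(\<lambda>n. c n * of_padic_int r ^ n) sums 0 \<longleftrightarrow> f r = 0"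
    using c[of r] sums_unique2 by metis
  with m have "m = 0 \<longleftrightarrow> f r \<noteq> 0" by simp
  moreover have "f x \<noteq> 0 \<and> padic_val (f x) = int m * int (padic_int_val (x - r)) + padic_val b"
    if "x = r \<longrightarrow> m = 0" "padic_residue x e = padic_residue r e" for x
  proof -
    let ?y = "of_padic_int (x - r)"
    have eq: "padic_norm (f x) = padic_norm (?y ^ m * b)"
      by (rule near[rule_format, OF _ that(2) c]) (use that(1) in simp)
    have nz: "?y ^ m \<noteq> 0" "?y ^ m * b \<noteq> 0" using that(1) b by auto
    then have "0 < padic_norm (f x)" unfolding eq by (intro padic_norm_pos)
    then have f: "f x \<noteq> 0" by auto
    have "padic_val (?y ^ m) = int m * int (padic_int_val (x - r))"
    proof (cases "x = r")
      case True
      then have "m = 0" using that(1) by blast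
      then show ?thesis using padic_val_of_padic_int[of "1 :: 'p padic_int"] by simp
    next
      case False
      have "padic_val (?y ^ m) = padic_val (of_padic_int ((x - r) ^ m))"
        by (simp add: of_padic_int_power)
      then show ?thesis
        using False by (simp add: padic_val_of_padic_int padic_int_val_power)
    qed
    then show ?thesis
      using f eq padic_norm_eq_iff_val[OF f nz(2)] nz b by (simp add: padic_val_mult)
  qed
  ultimately show ?thesis by blast
qed

section \<open>Residue classes on which the valuation is known\<close>

definition constant_class ::
  "('p::prime_cardinality padic_int \<Rightarrow> 'p padic) \<Rightarrow> nat \<Rightarrow> 'p padic_int \<Rightarrow> bool" where
  "constant_class f e x \<longleftrightarrow> (\<exists>v. \<forall>y. padic_residue y e = padic_residue x e \<longrightarrow>
    f y \<noteq> 0 \<and> padic_val (f y) = v)"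

text \<open>\<open>r\<close> is the only root in its class modulo \<open>p ^ e\<close>; for analytic
  \<open>f\<close> the exponent \<open>m\<close> is its multiplicity.\<close>

definition root_class ::
  "('p::prime_cardinality padic_int \<Rightarrow> 'p padic) \<Rightarrow> nat \<Rightarrow> 'p padic_int \<Rightarrow> bool" where
  "root_class f e r \<longleftrightarrow> f r = 0 \<and> (\<exists>m\<ge>1. \<exists>v. \<forall>y. y \<noteq> r \<longrightarrow>
    padic_residue y e = padic_residue r e \<longrightarrow>
    f y \<noteq> 0 \<and> padic_val (f y) = int m * int (padic_int_val (y - r)) + v)"

text \<open>Compactness makes the precision of the local descriptions uniform. For the monotonicity
  it needs, a root class splits under refinement into the class of the root and classes at constant
  distance from it.\<close>

lemma analytic_Zp_uniform_classes:
  fixes f :: "'p::prime_cardinality padic_int \<Rightarrow> 'p padic"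
  assumes "analytic_Zp f" "\<exists>x. f x \<noteq> 0"
  shows "\<exists>e. \<forall>x. constant_class f e x \<or>
    (\<exists>r. padic_residue r e = padic_residue x e \<and> root_class f e r)"
proof (rule padic_int_uniform)
  fix x
  obtain m v e where m: "m = 0 \<longleftrightarrow> f x \<noteq> 0"
    and near: "\<And>y. (y = x \<longrightarrow> m = 0) \<Longrightarrow> padic_residue y e = padic_residue x e \<Longrightarrow>
      f y \<noteq> 0 \<and> padic_val (f y) = int m * int (padic_int_val (y - x)) + v"
    using analytic_Zp_valuation_local[OF assms, of x] by blast
  show "\<exists>e. constant_class f e x \<or>
    (\<exists>r. padic_residue r e = padic_residue x e \<and> root_class f e r)"
  proof (cases "f x = 0")
    case True
    then have "root_class f e x"
      unfolding root_class_def using m near by (metis Suc_leI One_nat_def neq0_conv)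
    then show ?thesis by blast
  next
    case False
    then have "constant_class f e x"
      unfolding constant_class_def using m near by auto
    then show ?thesis by blast
  qed
next
  fix x y :: "'p padic_int" and d e :: nat
  assume "constant_class f d x \<or> (\<exists>r. padic_residue r d = padic_residue x d \<and> root_class f d r)"
    and "d \<le> e" and yx: "padic_residue y d = padic_residue x d"
  moreover have mono: "padic_residue z d = padic_residue w d"
    if "padic_residue z e = padic_residue w e" for z w :: "'p padic_int"
    using that \<open>d \<le> e\<close> by (rule padic_residue_eq_mono)
  ultimately consider "constant_class f d x" | r where "padic_residue r d = padic_residue x d" "root_class f d r"
    by blast
  then show "constant_class f e y \<or> (\<exists>r. padic_residue r e = padic_residue y e \<and> root_class f e r)"
  proof cases
    case 1
    then have "constant_class f e y"
      unfolding constant_class_def using mono yx by metis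
    then show ?thesis by blast
  next
    case 2
    then obtain m v where m: "m \<ge> 1" and near: "\<And>z. z \<noteq> r \<Longrightarrow>
        padic_residue z d = padic_residue x d \<Longrightarrow>
        f z \<noteq> 0 \<and> padic_val (f z) = int m * int (padic_int_val (z - r)) + v"
      unfolding root_class_def by auto
    show ?thesis
    proof (cases "padic_residue r e = padic_residue y e")
      case True
      have "root_class f e r"
        unfolding root_class_def using 2(2) m near mono True yx
        by (metis root_class_def)
      then show ?thesis using True by blast
    next
      case False
      \<comment> \<open>\<open>y\<close> and \<open>r\<close> differ modulo \<open>p ^ e\<close>, so
        all points congruent to \<open>y\<close> modulo \<open>p ^ e\<close> have the same distance
        from \<open>r\<close>.\<close>
      have "constant_class f e y"
        unfolding constant_class_def
      proof (intro exI allI impI)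
        fix z :: "'p padic_int" assume z: "padic_residue z e = padic_residue y e"
        have "padic_residue (z - y) (Suc (padic_int_val (y - r))) = 0"
          using False z padic_residue_eq_iff_val[of y r e] padic_residue_eq_mono[of z e y]
          by (metis not_less_eq_eq padic_residue_eq_iff_diff)
        moreover have "y - r \<noteq> 0" using False by auto
        ultimately have "y - r + (z - y) \<noteq> 0"
          "padic_int_val (y - r + (z - y)) = padic_int_val (y - r)"
          using padic_int_val_add_dominant by blast+
        then have "z \<noteq> r" "padic_int_val (z - r) = padic_int_val (y - r)" by auto
        then show "f z \<noteq> 0 \<and> padic_val (f z) = int m * int (padic_int_val (y - r)) + v"
          using near mono[OF z] yx by metis
      qed
      then show ?thesis by blast
    qed
  qed
qed

section \<open>Finitely generated modules of integer sequences\<close>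

text \<open>The integers are Noetherian. The coefficients that elements of \<open>N\<close> have at
  the new generator \<open>x\<close> form an ideal; an element with the least positive coefficient,
  if there is one, generates \<open>N\<close> together with the part of \<open>N\<close> in the span
  of \<open>G\<close>.\<close>

lemma int_seq_subspace_finitely_generated:
  assumes "finite G" "int_seq.subspace N" "N \<subseteq> int_seq.span G"
  shows "\<exists>F. finite F \<and> int_seq.span F = N"
  using assms
proof (induction G arbitrary: N rule: finite_induct)
  case empty
  then have "N = int_seq.span {}"
    using int_seq.subspace_0 by auto
  then show ?case by blast
next
  case (insert x G)
  note N = \<open>int_seq.subspace N\<close>
  let ?N' = "N \<inter> int_seq.span G"
  have "int_seq.subspace ?N'"
    using N by (intro int_seq.subspace_inter int_seq.subspace_span)
  then obtain F where F: "finite F" "int_seq.span F = ?N'"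
    using insert.IH by blast
  \<comment> \<open>\<open>x\<close> may depend on \<open>G\<close>, so an element can have several
    coefficients; \<open>D\<close> collects all of them.\<close>
  define D where "D = {k. \<exists>z\<in>N. z - scale_seq k x \<in> int_seq.span G}"
  have D: "\<exists>k\<in>D. z - scale_seq k x \<in> int_seq.span G" if z: "z \<in> N" for z
  proof -
    obtain k where "z - scale_seq k x \<in> int_seq.span G"
      using z insert.prems(2) int_seq.span_breakdown_eq[of z x G] by blast
    then show ?thesis using z by (auto simp: D_def)
  qed
  show ?case
  proof (cases "D \<subseteq> {0}")
    case True
    then have "z \<in> int_seq.span G" if z: "z \<in> N" for z
    proof -
      obtain k where k: "k \<in> D" "z - scale_seq k x \<in> int_seq.span G" using D[OF z] by blast
      then have "k = 0" using True by blast
      then show ?thesis using k(2) by simp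
    qed
    then show ?thesis using F by blast
  next
    case False
    then obtain k0 where "k0 \<in> D" "k0 \<noteq> 0" by auto
    have neg: "- k \<in> D" if "k \<in> D" for k
    proof -
      from that obtain z where z: "z \<in> N" "z - scale_seq k x \<in> int_seq.span G"
        by (auto simp: D_def)
      have "- z - scale_seq (- k) x = - (z - scale_seq k x)"
        by (simp add: fun_eq_iff scale_seq_def)
      then have "- z - scale_seq (- k) x \<in> int_seq.span G"
        using int_seq.span_neg[OF z(2)] by simp
      moreover have "- z \<in> N" using int_seq.subspace_neg[OF N z(1)] .
      ultimately show ?thesis unfolding D_def by blast
    qed
    have "\<exists>n::nat. 0 < n \<and> int n \<in> D"
      using \<open>k0 \<in> D\<close> \<open>k0 \<noteq> 0\<close> neg[OF \<open>k0 \<in> D\<close>]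
      by (intro exI[of _ "nat \<bar>k0\<bar>"]) (auto simp: abs_if)
    then obtain d where d: "0 < d" "int d \<in> D" and least: "\<And>n. 0 < n \<Longrightarrow> int n \<in> D \<Longrightarrow> d \<le> n"
      using exists_least_iff[of "\<lambda>n. 0 < n \<and> int n \<in> D"] by (metis not_less)
    obtain z0 where z0: "z0 \<in> N" "z0 - scale_seq (int d) x \<in> int_seq.span G"
      using d(2) by (auto simp: D_def)
    have "int_seq.span (insert z0 F) = N"
    proof
      show "int_seq.span (insert z0 F) \<subseteq> N"
        using z0(1) F(2) int_seq.span_superset[of F] by (intro int_seq.span_minimal N) auto
      show "N \<subseteq> int_seq.span (insert z0 F)"
      proof
        fix z assume z: "z \<in> N"
        from D[OF z] obtain k where k: "z - scale_seq k x \<in> int_seq.span G" by blast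
        \<comment> \<open>Division with remainder: the remainder is again in \<open>D\<close> and
          below \<open>d\<close>, hence 0.\<close>
        define q where "q = k div int d"
        have zq: "z - scale_seq q z0 \<in> N"
          using N z z0(1) by (intro int_seq.subspace_diff int_seq.subspace_scale)
        have "z - scale_seq q z0 - scale_seq (k mod int d) x =
            (z - scale_seq k x) - scale_seq q (z0 - scale_seq (int d) x)"
          by (simp add: fun_eq_iff scale_seq_def q_def algebra_simps minus_div_mult_eq_mod[symmetric])
        also have "\<dots> \<in> int_seq.span G"
          by (rule int_seq.span_diff[OF k int_seq.span_scale[OF z0(2)]])
        finally have *: "z - scale_seq q z0 - scale_seq (k mod int d) x \<in> int_seq.span G" .
        then have "k mod int d \<in> D"
          unfolding D_def using zq by blast
        then have "int (nat (k mod int d)) \<in> D"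
          using d(1) by simp
        moreover have "nat (k mod int d) < d"
          using d(1) by (simp add: nat_less_iff)
        ultimately have "nat (k mod int d) = 0"
          using least by (metis not_less neq0_conv)
        then have "k mod int d = 0"
          using d(1) by (simp add: nat_eq_iff)
        with * have "z - scale_seq q z0 \<in> int_seq.span F"
          using zq F(2) by simp
        then show "z \<in> int_seq.span (insert z0 F)"
          unfolding int_seq.span_breakdown_eq by blast
      qed
    qed
    then show ?thesis using F(1) by (metis finite_insert)
  qed
qed

text \<open>Regularity asks for finite generation of the span of the kernel itself. As this passes
  to submodules, any finite set whose span contains the kernel will do.\<close>

lemma k_regularI:
  assumes "finite G" "k_kernel k a \<subseteq> int_seq.span G"
  shows "k_regular k a"
  unfolding k_regular_def
  using int_seq_subspace_finitely_generated[OF assms(1) int_seq.subspace_span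
    int_seq.span_minimal[OF assms(2) int_seq.subspace_span]] by simp

section \<open>Kernel sequences\<close>

lemma k_kernelI: "j < k ^ i \<Longrightarrow> (\<lambda>n. a (k ^ i * n + j)) \<in> k_kernel k a"
  unfolding k_kernel_def by fastforce

lemma k_kernel_in_span:
  assumes "int_seq.span F = int_seq.span (k_kernel k a)" "j < k ^ i"
  shows "(\<lambda>n. a (k ^ i * n + j)) \<in> int_seq.span F"
  using int_seq.span_base[OF k_kernelI[OF assms(2)]] unfolding assms(1) .

text \<open>A kernel sequence depends only on \<open>k ^ i\<close> and \<open>j\<close> modulo
  \<open>T\<close>, so the kernel is finite for every \<open>k\<close>.\<close>

lemma periodic_imp_k_regular:
  assumes "has_period a T"
  shows "k_regular k a"
proof -
  have "0 < T" and step: "\<And>n. a (n + T) = a n"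
    using assms by (auto simp: has_period_def)
  have mod: "a (n mod T) = a n" for n
  proof -
    have "a (r + q * T) = a r" for r q
    proof (induction q)
      case (Suc q)
      then show ?case using step[of "r + q * T"] by (simp add: algebra_simps)
    qed simp
    from this[of "n mod T" "n div T"] show ?thesis by (simp add: mod_mult_div_eq)
  qed
  have "k_kernel k a \<subseteq> (\<lambda>(q, j) n. a (q * n + j)) ` ({..<T} \<times> {..<T})"
  proof
    fix h assume "h \<in> k_kernel k a"
    then obtain i j where h: "h = (\<lambda>n. a (k ^ i * n + j))"
      unfolding k_kernel_def by blast
    have "a (k ^ i * n + j) = a ((k ^ i mod T) * n + j mod T)" for n
    proof -
      have "((k ^ i mod T) * n + j mod T) mod T = ((k ^ i mod T) * n mod T + j mod T mod T) mod T"
        by (rule mod_add_eq[symmetric])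
      also have "\<dots> = (k ^ i * n mod T + j mod T) mod T"
        by (simp only: mod_mult_left_eq mod_mod_trivial)
      also have "\<dots> = (k ^ i * n + j) mod T"
        by (rule mod_add_eq)
      finally show ?thesis
        using mod[of "k ^ i * n + j"] mod[of "(k ^ i mod T) * n + j mod T"] by (simp only:)
    qed
    then show "h \<in> (\<lambda>(q, j) n. a (q * n + j)) ` ({..<T} \<times> {..<T})"
      using \<open>0 < T\<close> unfolding h by (intro image_eqI[of _ _ "(k ^ i mod T, j mod T)"]) auto
  qed
  then have "finite (k_kernel k a)"
    by (rule finite_subset) simp
  then show ?thesis unfolding k_regular_def by blast
qed

text \<open>As for a finite-dimensional space of functions, finitely many evaluations detect
  vanishing on \<open>X\<close>. Each new generator costs at most one new point \<open>x0\<close>,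
  where some \<open>h0\<close> that vanishes on \<open>S\<close> does not vanish.\<close>

lemma int_seq_finite_test_set:
  assumes "finite G"
  shows "\<exists>S\<subseteq>X. finite S \<and> (\<forall>h\<in>int_seq.span G. (\<forall>s\<in>S. h s = 0) \<longrightarrow> (\<forall>x\<in>X. h x = 0))"
  using assms
proof (induction G rule: finite_induct)
  case empty
  then show ?case by (intro exI[of _ "{}"]) auto
next
  case (insert g G)
  then obtain S where S: "S \<subseteq> X" "finite S"
    and test: "\<And>h x. h \<in> int_seq.span G \<Longrightarrow> (\<forall>s\<in>S. h s = 0) \<Longrightarrow> x \<in> X \<Longrightarrow> h x = 0"
    by blast
  show ?case
  proof (cases "\<forall>h\<in>int_seq.span (insert g G). (\<forall>s\<in>S. h s = 0) \<longrightarrow> (\<forall>x\<in>X. h x = 0)")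
    case True
    then show ?thesis using S by blast
  next
    case False
    then obtain h0 x0 where h0: "h0 \<in> int_seq.span (insert g G)" "\<And>s. s \<in> S \<Longrightarrow> h0 s = 0"
      and x0: "x0 \<in> X" "h0 x0 \<noteq> 0" by blast
    obtain k0 where k0: "h0 - scale_seq k0 g \<in> int_seq.span G"
      using h0(1) by (auto simp: int_seq.span_breakdown_eq)
    have "h x = 0" if h: "h \<in> int_seq.span (insert g G)" "\<forall>s\<in>insert x0 S. h s = 0" and "x \<in> X" for h x
    proof -
      obtain k where k: "h - scale_seq k g \<in> int_seq.span G"
        using h(1) by (auto simp: int_seq.span_breakdown_eq)
      \<comment> \<open>Cross-multiplying removes \<open>g\<close> without division. Evaluating
        \<open>?w\<close> at \<open>x0\<close> then forces \<open>k = 0\<close>.\<close>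
      let ?w = "scale_seq k0 h - scale_seq k h0"
      have "?w = scale_seq k0 (h - scale_seq k g) - scale_seq k (h0 - scale_seq k0 g)"
        by (simp add: fun_eq_iff scale_seq_def algebra_simps)
      also have "\<dots> \<in> int_seq.span G"
        by (rule int_seq.span_diff[OF int_seq.span_scale[OF k] int_seq.span_scale[OF k0]])
      finally have w: "?w y = 0" if "y \<in> X" for y
        by (rule test) (use h0(2) h(2) that in \<open>auto simp: scale_seq_def\<close>)
      have "k = 0" using w[OF x0(1)] x0(2) h(2) by (auto simp: scale_seq_def)
      with k have "h \<in> int_seq.span G" by simp
      then show ?thesis using test h(2) \<open>x \<in> X\<close> by auto
    qed
    then have "\<forall>h\<in>int_seq.span (insert g G). (\<forall>s\<in>insert x0 S. h s = 0) \<longrightarrow> (\<forall>x\<in>X. h x = 0)"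
      by blast
    moreover have "insert x0 S \<subseteq> X" "finite (insert x0 S)" using S x0(1) by simp_all
    ultimately show ?thesis by blast
  qed
qed

section \<open>Dependence in infinite families\<close>

lemma int_seq_span_finite_support:
  assumes "x \<in> int_seq.span (b ` UNIV)"
  shows "\<exists>I. finite I \<and> x \<in> int_seq.span (b ` I)"
  using assms
proof (induction rule: int_seq.span_induct_alt)
  case base
  show ?case using int_seq.span_zero by (metis finite.emptyI)
next
  case (step c y z)
  then obtain I where I: "finite I" "z \<in> int_seq.span (b ` I)" by blast
  obtain i where y: "y = b i" using step(1) by blast
  have z: "z \<in> int_seq.span (b ` insert i I)"
    using I(2) int_seq.span_mono[of "b ` I" "b ` insert i I"] by blast
  have "b i \<in> int_seq.span (b ` insert i I)"
    by (rule int_seq.span_base) simp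
  then have "scale_seq c y + z \<in> int_seq.span (b ` insert i I)"
    unfolding y by (rule int_seq.span_add[OF int_seq.span_scale z])
  moreover have "finite (insert i I)" using I(1) by simp
  ultimately show ?case by blast
qed

text \<open>The span of the family is finitely generated, and its generators involve only finitely
  many members \<open>I\<close>; every member outside \<open>I\<close> depends on these.\<close>

lemma int_seq_family_dependent:
  fixes b :: "nat \<Rightarrow> nat \<Rightarrow> int"
  assumes "finite G" "\<And>i. b i \<in> int_seq.span G"
  shows "\<exists>I i. finite I \<and> i \<notin> I \<and> b i \<in> int_seq.span (b ` I)"
proof -
  have "int_seq.span (range b) \<subseteq> int_seq.span G"
    using assms(2) by (intro int_seq.span_minimal int_seq.subspace_span) auto
  then obtain F where F: "finite F" "int_seq.span F = int_seq.span (range b)"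
    using int_seq_subspace_finitely_generated[OF assms(1) int_seq.subspace_span] by blast
  have "F \<subseteq> int_seq.span (range b)" using F(2) int_seq.span_superset by blast
  then have "\<forall>x\<in>F. \<exists>I. finite I \<and> x \<in> int_seq.span (b ` I)"
    using int_seq_span_finite_support by blast
  then obtain J where J: "\<And>x. x \<in> F \<Longrightarrow> finite (J x) \<and> x \<in> int_seq.span (b ` J x)" by metis
  define I where "I = (\<Union>x\<in>F. J x)"
  have "finite I" using F(1) J by (auto simp: I_def)
  then obtain i where "i \<notin> I" using ex_new_if_finite infinite_UNIV_nat by blast
  have "x \<in> int_seq.span (b ` I)" if "x \<in> F" for x
    using J[OF that] int_seq.span_mono[of "b ` J x" "b ` I"] that by (auto simp: I_def)
  then have "int_seq.span F \<subseteq> int_seq.span (b ` I)"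
    by (intro int_seq.span_minimal int_seq.subspace_span) auto
  then have "b i \<in> int_seq.span (b ` I)"
    using F(2) int_seq.span_base[of "b i" "range b"] by auto
  then show ?thesis using \<open>finite I\<close> \<open>i \<notin> I\<close> by blast
qed

lemma int_seq_span_eq_at:
  assumes "h \<in> int_seq.span B" "\<And>g. g \<in> B \<Longrightarrow> g x = g y"
  shows "h x = h y"
  using assms(1)
proof (induction rule: int_seq.span_induct_alt)
  case (step c g h)
  then show ?case using assms(2) by (simp add: scale_seq_def)
qed simp

section \<open>Regularity of the valuation sequence\<close>

lemma nu_sequenceD:
  assumes "nu_sequence l f a" "f (of_nat n) \<noteq> 0"
  shows "a n = padic_val (f (of_nat n)) div int l"
proof -
  have "\<lfloor>real_of_int z / real l\<rfloor> = z div int l" for z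
    using floor_divide_of_int_eq[of z "int l", where 'a=real] by simp
  then show ?thesis
    using assms(1)[unfolded nu_sequence_def, rule_format, of n] assms(2) by (simp add: nu_def)
qed

lemma constant_class_sequence:
  fixes f :: "'p::prime_cardinality padic_int \<Rightarrow> 'p padic"
  assumes "nu_sequence l f a" "constant_class f e x"
  shows "\<exists>w. \<forall>n. padic_residue (of_nat n :: 'p padic_int) e = padic_residue x e \<longrightarrow> a n = w"
proof -
  obtain v where "\<forall>y. padic_residue y e = padic_residue x e \<longrightarrow> f y \<noteq> 0 \<and> padic_val (f y) = v"
    using assms(2) unfolding constant_class_def by blast
  then show ?thesis
    using nu_sequenceD[OF assms(1)] by (intro exI[of _ "v div int l"]) simp
qed

lemma root_class_sequence:
  fixes f :: "'p::prime_cardinality padic_int \<Rightarrow> 'p padic"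
  assumes "nu_sequence l f a" "root_class f e r"
  shows "\<exists>m\<ge>1. \<exists>v. \<forall>n. of_nat n \<noteq> r \<longrightarrow> padic_residue (of_nat n :: 'p padic_int) e = padic_residue r e \<longrightarrow>
    a n = (int m * int (padic_int_val (of_nat n - r)) + v) div int l"
proof -
  obtain m v where m: "m \<ge> 1" and "\<forall>y. y \<noteq> r \<longrightarrow> padic_residue y e = padic_residue r e \<longrightarrow>
      f y \<noteq> 0 \<and> padic_val (f y) = int m * int (padic_int_val (y - r)) + v"
    using assms(2) unfolding root_class_def by blast
  then have "\<forall>n. of_nat n \<noteq> r \<longrightarrow> padic_residue (of_nat n :: 'p padic_int) e = padic_residue r e \<longrightarrow>
    a n = (int m * int (padic_int_val (of_nat n - r)) + v) div int l"
    using nu_sequenceD[OF assms(1)] by simp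
  with m show ?thesis by blast
qed

lemma padic_residue_CARD_power_mult:
  assumes "e \<le> i"
  shows "padic_residue (of_nat (CARD('p) ^ i * n + j) :: 'p::prime_cardinality padic_int) e =
    padic_residue (of_nat j :: 'p padic_int) e"
proof -
  have "int CARD('p) ^ e dvd int CARD('p) ^ i"
    using assms by (rule le_imp_power_dvd)
  then have "(int CARD('p) ^ i * int n + int j) mod int CARD('p) ^ e = int j mod int CARD('p) ^ e"
    by (metis dvd_def mod_mult_self4 mult.assoc)
  then show ?thesis
    unfolding padic_residue_of_nat by (simp only: of_nat_add of_nat_mult of_nat_power)
qed

lemma rootless_imp_power_period:
  fixes f :: "'p::prime_cardinality padic_int \<Rightarrow> 'p padic"
  assumes "nu_sequence l f a" "\<And>x. constant_class f e x"
  shows "has_period a (CARD('p) ^ e)"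
  unfolding has_period_def
proof (intro conjI allI)
  show "0 < CARD('p) ^ e"
    using prime_gt_0_nat[OF prime_CARD[where 'a='p]] by simp
  fix n
  obtain w where w: "\<And>k. padic_residue (of_nat k :: 'p padic_int) e = padic_residue (of_nat n :: 'p padic_int) e \<Longrightarrow> a k = w"
    using constant_class_sequence[OF assms(1,2)] by blast
  have "padic_residue (of_nat (n + CARD('p) ^ e) :: 'p padic_int) e = padic_residue (of_nat n :: 'p padic_int) e"
    using padic_residue_CARD_power_mult[where 'p='p, of e e 1 n] by (simp only: mult_1_right add.commute)
  then show "a (n + CARD('p) ^ e) = a n" using w[of n] w[of "n + CARD('p) ^ e"] by simp
qed

text \<open>After \<open>p ^ i\<close> is factored out, \<open>i\<close> enters the floor only
  through \<open>i mod l\<close>, up to an additive constant, and the remaining parameter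
  \<open>Q\<close> is bounded.\<close>

lemma kernel_rational_root:
  fixes r :: "'p::prime_cardinality padic_int" and a :: "nat \<Rightarrow> int"
  assumes "l \<ge> 1" "of_padic_int r \<in> \<rat>"
    and a: "\<And>n. of_nat n \<noteq> r \<Longrightarrow> padic_residue (of_nat n :: 'p padic_int) e = padic_residue r e \<Longrightarrow>
      a n = (int m * int (padic_int_val (of_nat n - r)) + v) div int l"
  shows "\<exists>G. finite G \<and> (\<forall>i\<ge>e. \<forall>j<CARD('p) ^ i. padic_residue (of_nat j :: 'p padic_int) e = padic_residue r e \<longrightarrow>
    (\<lambda>n. a (CARD('p) ^ i * n + j)) \<in> int_seq.span G)"
proof -
  let ?p = "CARD('p)"
  obtain u w where w: "w > 0" and uw: "of_padic_int r = of_int u / of_int w"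
    using assms(2) by (rule Rats_cases')
  have "of_padic_int (of_int w * r) = of_padic_int (of_int u)"
    using w unfolding of_padic_int_mult of_padic_int_of_int uw by simp
  then have wr: "of_int w * r = of_int u" by simp
  have w0: "(of_int w :: 'p padic_int) \<noteq> 0" using w by simp
  \<comment> \<open>\<open>w * j - u = p ^ i * Q\<close> with \<open>j < p ^ i\<close> gives
    \<open>\<bar>Q\<bar> \<le> w + \<bar>u\<bar>\<close>.\<close>
  define B where "B = w + \<bar>u\<bar>"
  define one :: "nat \<Rightarrow> int" where "one = (\<lambda>_. 1)"
  \<comment> \<open>\<open>w * n + Q = 0\<close> means that \<open>p ^ i * n + j\<close> is the
    root, where \<open>a\<close> is an arbitrary integer; multiples of \<open>\<Delta> Q\<close>
    absorb that value.\<close>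
  define \<Delta> :: "int \<Rightarrow> nat \<Rightarrow> int" where "\<Delta> Q n = (if w * int n + Q = 0 then 1 else 0)" for Q n
  \<comment> \<open>The formula for \<open>a\<close> with the valuation taken of
    \<open>p ^ i * (w * n + Q) / w\<close>; the value 0 at the root is a default.\<close>
  define H where "H Q i n = (if w * int n + Q = 0 then 0 else
    (int m * (int i + int (padic_int_val (of_int (w * int n + Q) :: 'p padic_int))
      - int (padic_int_val (of_int w :: 'p padic_int))) + v) div int l)" for Q and i n :: nat
  define G where "G = {one} \<union> \<Delta> ` {-B..B} \<union> (\<lambda>(Q, i). H Q i) ` ({-B..B} \<times> {..<l})"
  have "finite G" by (simp add: G_def)
  moreover have "(\<lambda>n. a (?p ^ i * n + j)) \<in> int_seq.span G"
    if i: "i \<ge> e" and j: "j < ?p ^ i" and je: "padic_residue (of_nat j :: 'p padic_int) e = padic_residue r e" for i j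
  proof (cases "padic_residue (of_nat j :: 'p padic_int) i = padic_residue r i")
    \<comment> \<open>\<open>j\<close> differs from \<open>r\<close> modulo \<open>p ^ i\<close>:
      adding multiples of \<open>p ^ i\<close> keeps the distance to \<open>r\<close>, and the
      kernel sequence is constant.\<close>
    case False
    then have jr: "of_nat j \<noteq> r" by auto
    have "a (?p ^ i * n + j) = (int m * int (padic_int_val (of_nat j - r)) + v) div int l" for n
    proof -
      let ?x = "of_nat (?p ^ i * n + j) :: 'p padic_int"
      have "Suc (padic_int_val (of_nat j - r)) \<le> i"
        using False padic_residue_eq_iff_val[OF jr] by simp
      then have "padic_residue ?x (Suc (padic_int_val (of_nat j - r))) =
          padic_residue (of_nat j :: 'p padic_int) (Suc (padic_int_val (of_nat j - r)))"
        by (rule padic_residue_CARD_power_mult)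
      then have *: "padic_residue (?x - of_nat j) (Suc (padic_int_val (of_nat j - r))) = 0"
        by (simp only: padic_residue_eq_iff_diff)
      have "of_nat j - r \<noteq> 0" using jr by simp
      note dom = padic_int_val_add_dominant[OF this *]
      have "?x \<noteq> r" "padic_int_val (?x - r) = padic_int_val (of_nat j - r)"
        using dom by (simp_all add: algebra_simps)
      moreover have "padic_residue ?x e = padic_residue r e"
        using padic_residue_CARD_power_mult[OF i, where 'p='p, of n j] je by simp
      ultimately show ?thesis using a by metis
    qed
    then have "(\<lambda>n. a (?p ^ i * n + j)) =
        scale_seq ((int m * int (padic_int_val (of_nat j - r)) + v) div int l) one"
      by (simp add: scale_seq_def one_def)
    moreover have "one \<in> G" by (simp add: G_def)
    ultimately show ?thesis by (simp add: int_seq.span_base int_seq.span_scale)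
  next
    case True
    then have "padic_residue (of_nat j - r) i = 0"
      by (simp only: padic_residue_eq_iff_diff)
    then have "padic_residue ((of_nat j - r) * of_int w) i = 0"
      by (rule padic_residue_mult_eq_0)
    moreover have wj: "(of_nat j - r) * of_int w = of_int (w * int j - u)"
      using wr by (simp add: algebra_simps)
    ultimately have "int ?p ^ i dvd w * int j - u"
      by (simp only: padic_residue_of_int mod_eq_0_iff_dvd)
    then obtain Q where Q: "w * int j - u = int ?p ^ i * Q" by (rule dvdE)
    have pi: "0 < int ?p ^ i"
      using prime_gt_0_nat[OF prime_CARD[where 'a='p]] by simp
    have "\<bar>Q\<bar> \<le> B"
    proof -
      have "int ?p ^ i * \<bar>Q\<bar> = \<bar>w * int j - u\<bar>"
        using pi by (simp add: Q abs_mult)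
      also have "\<dots> \<le> w * int j + \<bar>u\<bar>"
        using mult_nonneg_nonneg[of w "int j"] w by linarith
      also have "w * int j \<le> w * int ?p ^ i"
        using w j by (intro mult_left_mono) (simp_all flip: of_nat_power)
      also have "\<bar>u\<bar> \<le> \<bar>u\<bar> * int ?p ^ i"
        using mult_left_mono[of 1 "int ?p ^ i" "\<bar>u\<bar>"] pi by linarith
      finally have "int ?p ^ i * \<bar>Q\<bar> \<le> int ?p ^ i * B"
        by (simp add: B_def algebra_simps)
      then show ?thesis using pi by simp
    qed
    then have QB: "Q \<in> {-B..B}" by auto
    let ?h = "\<lambda>n. a (?p ^ i * n + j)"
    \<comment> \<open>In \<open>i = i mod l + l * (i div l)\<close> the second part leaves the floor
      as \<open>?q\<close>.\<close>
    let ?q = "int m * (int i div int l)"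
    have shift: "M * (I + y - z) + v = L * (M * d) + (M * (i' + y - z) + v)"
      if "I = i' + L * d" for M I y z L d i' :: int
      unfolding that by (simp add: algebra_simps)
    have h: "?h n = H Q (i mod l) n + ?q" if n: "w * int n + Q \<noteq> 0" for n
    proof -
      let ?x = "of_nat (?p ^ i * n + j) :: 'p padic_int" and ?y = "of_int (w * int n + Q) :: 'p padic_int"
      have "of_int w * (?x - r) = of_int w * of_nat (?p ^ i) * of_nat n + (of_nat j - r) * of_int w"
        by (simp add: algebra_simps)
      also have "\<dots> = of_nat ?p ^ i * ?y"
        unfolding wj Q by (simp add: algebra_simps)
      finally have eq: "of_int w * (?x - r) = of_nat ?p ^ i * ?y" .
      have y: "?y \<noteq> 0" using n by (simp only: of_int_eq_0_iff not_False_eq_True)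
      have p0: "(of_nat ?p ^ i :: 'p padic_int) \<noteq> 0"
        using prime_gt_0_nat[OF prime_CARD[where 'a='p]] by simp
      have "of_nat ?p ^ i * ?y \<noteq> 0" using y p0 by (simp only: mult_eq_0_iff simp_thms)
      then have x: "?x - r \<noteq> 0" using eq by auto
      have "padic_int_val (of_int w :: 'p padic_int) + padic_int_val (?x - r) = i + padic_int_val ?y"
        using arg_cong[OF eq, of padic_int_val]
        unfolding padic_int_val_mult[OF w0 x] padic_int_val_mult[OF p0 y] padic_int_val_CARD_power .
      then have val: "int (padic_int_val (?x - r)) =
          int i + int (padic_int_val ?y) - int (padic_int_val (of_int w :: 'p padic_int))" by linarith
      have "padic_residue ?x e = padic_residue r e"
        using padic_residue_CARD_power_mult[OF i, where 'p='p, of n j] je by simp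
      moreover have "?x \<noteq> r" using x by auto
      ultimately have "?h n = (int m * int (padic_int_val (?x - r)) + v) div int l"
        using a by blast
      also have "int m * int (padic_int_val (?x - r)) + v =
          int l * ?q + (int m * (int (i mod l) + int (padic_int_val ?y)
            - int (padic_int_val (of_int w :: 'p padic_int))) + v)"
        unfolding val by (rule shift) (simp add: zmod_int)
      also have "\<dots> div int l = H Q (i mod l) n + ?q"
        using n \<open>l \<ge> 1\<close> by (simp add: H_def)
      finally show ?thesis .
    qed
    \<comment> \<open>As \<open>w\<close> is positive, at most one \<open>n\<close> hits the root,
      so a single constant \<open>C\<close> corrects it.\<close>
    obtain C where C: "?h n = H Q (i mod l) n + ?q + C" if "w * int n + Q = 0" for n
    proof (cases "\<exists>n. w * int n + Q = 0")
      case True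
      then obtain s where s: "w * int s + Q = 0" by blast
      have "n = s" if "w * int n + Q = 0" for n
      proof -
        have "w * int n = w * int s" using s that by linarith
        then show ?thesis using w by simp
      qed
      then show ?thesis using that[of "?h s - (H Q (i mod l) s + ?q)"] by force
    qed (use that in blast)
    have "?h = H Q (i mod l) + scale_seq ?q one + scale_seq C (\<Delta> Q)"
    proof
      fix n
      show "?h n = (H Q (i mod l) + scale_seq ?q one + scale_seq C (\<Delta> Q)) n"
        using h[of n] C[of n] by (cases "w * int n + Q = 0") (simp_all add: scale_seq_def one_def \<Delta>_def)
    qed
    moreover have "H Q (i mod l) \<in> G"
      unfolding G_def using QB \<open>l \<ge> 1\<close> by (intro UnI2 image_eqI[of _ _ "(Q, i mod l)"]) auto
    moreover have "one \<in> G" "\<Delta> Q \<in> G" using QB by (simp_all add: G_def)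
    ultimately show ?thesis by (simp only: int_seq.span_add int_seq.span_scale int_seq.span_base)
  qed
  ultimately show ?thesis by blast
qed

text \<open>For \<open>i \<ge> e\<close> the class of \<open>p ^ i * n + j\<close> modulo
  \<open>p ^ e\<close> is that of \<open>j\<close>, so the \<open>p ^ e\<close> classes are treated
  separately; the finitely many kernel sequences with \<open>i < e\<close> are added as
  generators.\<close>

lemma rational_roots_imp_CARD_regular:
  fixes f :: "'p::prime_cardinality padic_int \<Rightarrow> 'p padic"
  assumes "l \<ge> 1" "nu_sequence l f a" "of_padic_int ` roots_Zp f \<subseteq> \<rat>"
    and classes: "\<And>x. constant_class f e x \<or>
      (\<exists>r. padic_residue r e = padic_residue x e \<and> root_class f e r)"
  shows "k_regular CARD('p) a"
proof -
  let ?p = "CARD('p)"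
  have "\<exists>G. finite G \<and> (\<forall>i\<ge>e. \<forall>j<?p ^ i.
      padic_residue (of_nat j :: 'p padic_int) e = padic_residue (of_nat c :: 'p padic_int) e \<longrightarrow>
      (\<lambda>n. a (?p ^ i * n + j)) \<in> int_seq.span G)" for c
    using classes[of "of_nat c"]
  proof (elim disjE exE conjE)
    assume "constant_class f e (of_nat c)"
    then obtain w where w: "\<And>n. padic_residue (of_nat n :: 'p padic_int) e = padic_residue (of_nat c :: 'p padic_int) e \<Longrightarrow> a n = w"
      using constant_class_sequence[OF assms(2)] by blast
    have "(\<lambda>n. a (?p ^ i * n + j)) \<in> int_seq.span {\<lambda>_. 1}"
      if "i \<ge> e" "padic_residue (of_nat j :: 'p padic_int) e = padic_residue (of_nat c :: 'p padic_int) e" for i j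
    proof -
      have "a (?p ^ i * n + j) = w" for n
        using w[of "?p ^ i * n + j"] padic_residue_CARD_power_mult[OF that(1), where 'p='p, of n j] that(2)
        by (simp only:)
      then have "(\<lambda>n. a (?p ^ i * n + j)) = scale_seq w (\<lambda>_. 1)"
        by (simp add: scale_seq_def)
      then show ?thesis by (simp add: int_seq.span_base int_seq.span_scale)
    qed
    then show ?thesis by (intro exI[of _ "{\<lambda>_. 1}"]) auto
  next
    fix r assume r: "padic_residue r e = padic_residue (of_nat c :: 'p padic_int) e" "root_class f e r"
    obtain m v where near: "\<And>n. of_nat n \<noteq> r \<Longrightarrow> padic_residue (of_nat n :: 'p padic_int) e = padic_residue r e \<Longrightarrow>
        a n = (int m * int (padic_int_val (of_nat n - r)) + v) div int l"
      using root_class_sequence[OF assms(2) r(2)] by blast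
    have rational: "of_padic_int r \<in> \<rat>"
      using r(2) assms(3) by (auto simp: root_class_def roots_Zp_def)
    show ?thesis
      unfolding r(1)[symmetric] by (rule kernel_rational_root[OF \<open>l \<ge> 1\<close> rational]) (rule near)
  qed
  then have "\<exists>G. \<forall>c. finite (G c) \<and> (\<forall>i\<ge>e. \<forall>j<?p ^ i.
      padic_residue (of_nat j :: 'p padic_int) e = padic_residue (of_nat c :: 'p padic_int) e \<longrightarrow>
      (\<lambda>n. a (?p ^ i * n + j)) \<in> int_seq.span (G c))"
    by (intro choice allI)
  then obtain G where G: "\<forall>c. finite (G c) \<and> (\<forall>i\<ge>e. \<forall>j<?p ^ i.
      padic_residue (of_nat j :: 'p padic_int) e = padic_residue (of_nat c :: 'p padic_int) e \<longrightarrow>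
      (\<lambda>n. a (?p ^ i * n + j)) \<in> int_seq.span (G c))" ..
  define G' where "G' = (\<Union>c<?p ^ e. G c) \<union> (\<Union>i<e. \<Union>j<?p ^ i. {\<lambda>n. a (?p ^ i * n + j)})"
  have pos: "0 < ?p ^ i" for i
    using prime_gt_0_nat[OF prime_CARD[where 'a='p]] by simp
  show ?thesis
  proof (rule k_regularI)
    show "finite G'" using G by (simp add: G'_def)
    show "k_kernel ?p a \<subseteq> int_seq.span G'"
    proof
      fix h assume "h \<in> k_kernel ?p a"
      then obtain i j where h: "h = (\<lambda>n. a (?p ^ i * n + j))" and "j \<le> ?p ^ i - 1"
        unfolding k_kernel_def by blast
      then have j: "j < ?p ^ i" using pos[of i] by linarith
      show "h \<in> int_seq.span G'"
      proof (cases "i < e")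
        case True
        then have "h \<in> G'" using h j by (auto simp: G'_def)
        then show ?thesis by (rule int_seq.span_base)
      next
        case False
        obtain c where c: "c < ?p ^ e" "padic_residue (of_nat c :: 'p padic_int) e = padic_residue (of_nat j :: 'p padic_int) e"
          using ex_nat_padic_residue by blast
        have "h \<in> int_seq.span (G c)"
          unfolding h using G False j c(2) by simp
        moreover have "G c \<subseteq> G'" using c(1) by (auto simp: G'_def)
        ultimately show ?thesis using int_seq.span_mono by blast
      qed
    qed
  qed
qed

section \<open>Non-regularity\<close>

text \<open>A multiple of \<open>l\<close> passes through the floor. For \<open>m \<ge> 1\<close>,
  two valuations that differ by \<open>l\<close> thus give different terms whatever the
  rounding.\<close>

lemma affine_div_step:
  assumes "l \<ge> (1::nat)"
  shows "(int m * int (t + l) + v) div int l = (int m * int t + v) div int l + int m"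
proof -
  have "int m * int (t + l) + v = int m * int t + v + int m * int l"
    by (simp add: algebra_simps)
  then show ?thesis using assms by (simp only:) (subst div_mult_self1, simp_all)
qed

text \<open>The p-free part \<open>k'\<close> of \<open>k\<close> lets \<open>k ^ i\<close> exceed
  \<open>p ^ (\<sigma> * i)\<close> by any factor, which leaves room for \<open>j < k ^ i\<close>
  that bring \<open>k ^ i * N + j\<close> to prescribed distances from \<open>r\<close>.\<close>

lemma root_imp_not_k_regular:
  fixes r :: "'p::prime_cardinality padic_int" and a :: "nat \<Rightarrow> int"
  assumes "l \<ge> 1" "m \<ge> 1"
    and a: "\<And>n. of_nat n \<noteq> r \<Longrightarrow> padic_residue (of_nat n :: 'p padic_int) e = padic_residue r e \<Longrightarrow>
      a n = (int m * int (padic_int_val (of_nat n - r)) + v) div int l"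
    and k: "k = CARD('p) ^ \<sigma> * k'" "\<not> CARD('p) dvd k'" "k' \<ge> 2"
  shows "\<not> k_regular k a"
proof
  let ?p = "CARD('p)"
  let ?V = "padic_int_val :: 'p padic_int \<Rightarrow> nat"
  assume "k_regular k a"
  then obtain F where F: "finite F" "int_seq.span F = int_seq.span (k_kernel k a)"
    unfolding k_regular_def by blast
  have p: "0 < ?p" by (rule prime_gt_0_nat[OF prime_CARD])
  \<comment> \<open>For \<open>n\<close> in \<open>X\<close> the class of
    \<open>k ^ i * n + j\<close> modulo \<open>p ^ e\<close> does not depend on \<open>n\<close>, so
    all points used lie in the class of \<open>r\<close> once one does.\<close>
  define X where "X = range (\<lambda>n. ?p ^ e * n)"
  obtain S where S: "S \<subseteq> X" "finite S"
    and test: "\<And>h x. h \<in> int_seq.span F \<Longrightarrow> (\<forall>s\<in>S. h s = 0) \<Longrightarrow> x \<in> X \<Longrightarrow> h x = 0"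
    using int_seq_finite_test_set[OF F(1), of X] by blast
  have "inj (\<lambda>n. ?p ^ e * n)" using p by (intro injI) simp
  then have "infinite X"
    unfolding X_def using finite_imageD infinite_UNIV_nat by blast
  then obtain N where N: "N \<in> X" "N \<notin> S" using S(2) by (metis finite_subset subsetI)
  obtain T0 where T0: "\<And>s. s \<in> S \<Longrightarrow> ?V (of_nat s - of_nat N) < T0"
    using S(2) finite_nat_set_iff_bounded[of "(\<lambda>s. ?V (of_nat s - of_nat N)) ` S"] by auto
  \<comment> \<open>\<open>T0\<close> makes \<open>k ^ i * N + j\<close> nearer to \<open>r\<close>
    than to every \<open>k ^ i * s + j\<close>; \<open>e\<close> puts it into the class of
    \<open>r\<close>.\<close>
  define T where "T = e + T0"
  \<comment> \<open>Large enough for \<open>k' ^ i\<close> to exceed \<open>p ^ (T + l + 1)\<close>,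
    which leaves room for all valuations \<open>\<sigma> * i + t\<close> with
    \<open>t \<le> T + l\<close>.\<close>
  define i where "i = ?p ^ (T + l + 1)"
  have "?p ^ (T + l + 1) < 2 ^ i" unfolding i_def by (rule less_exp)
  also have "2 ^ i \<le> k' ^ i" using k(3) by (rule power_mono) simp
  finally have k'_i: "?p ^ (T + l + 1) \<le> k' ^ i" by simp
  have k': "(of_nat k' :: 'p padic_int) \<noteq> 0" using k(3) by simp
  have p0: "(of_nat ?p :: 'p padic_int) \<noteq> 0" using p by simp
  have Vk: "?V (of_nat k ^ i) = \<sigma> * i"
  proof -
    have "(of_nat k ^ i :: 'p padic_int) = of_nat ?p ^ (\<sigma> * i) * of_nat k' ^ i"
      by (simp add: k(1) power_mult_distrib power_mult)
    moreover have "?V (of_nat k' ^ i) = 0"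
      using padic_int_val_of_nat_eq_0[OF k(2)] k' by (simp add: padic_int_val_power)
    ultimately show ?thesis
      using k' p0 by (simp add: padic_int_val_mult padic_int_val_CARD_power)
  qed
  have k0: "(of_nat k ^ i :: 'p padic_int) \<noteq> 0" using k' p0 by (simp add: k(1))
  have ex_j: "\<exists>j < k ^ i. of_nat (k ^ i * N + j) \<noteq> r \<and> ?V (of_nat (k ^ i * N + j) - r) = \<sigma> * i + t"
    if "t \<le> T + l" for t
  proof -
    obtain j where j: "j < ?p ^ Suc (\<sigma> * i + t)" "of_nat j \<noteq> r - of_nat (k ^ i * N)"
      "?V (of_nat j - (r - of_nat (k ^ i * N))) = \<sigma> * i + t"
      using ex_nat_padic_int_val by blast
    have "?p ^ Suc (\<sigma> * i + t) = ?p ^ (\<sigma> * i) * ?p ^ (t + 1)"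
      by (simp add: power_add)
    also have "\<dots> \<le> ?p ^ (\<sigma> * i) * ?p ^ (T + l + 1)"
      using that p by (intro mult_left_mono power_increasing) auto
    also have "\<dots> \<le> ?p ^ (\<sigma> * i) * k' ^ i"
      using k'_i by (rule mult_left_mono) simp
    also have "\<dots> = k ^ i"
      by (simp add: k(1) power_mult_distrib power_mult)
    finally have "j < k ^ i" using j(1) by simp
    moreover have "of_nat j - (r - of_nat (k ^ i * N)) = of_nat (k ^ i * N + j) - r"
      by simp
    ultimately show ?thesis using j(2,3) by (intro exI[of _ j]) (auto simp: algebra_simps)
  qed
  have at_N: "a (k ^ i * N + j) = (int m * int (\<sigma> * i + t) + v) div int l"
    if "t \<ge> T" "of_nat (k ^ i * N + j) \<noteq> r" "?V (of_nat (k ^ i * N + j) - r) = \<sigma> * i + t" for j t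
  proof -
    have "padic_residue (of_nat (k ^ i * N + j) :: 'p padic_int) e = padic_residue r e"
      unfolding padic_residue_eq_iff_val[OF that(2)] that(3) using that(1) by (simp add: T_def)
    from a[OF that(2) this] show ?thesis unfolding that(3) .
  qed
  \<comment> \<open>In \<open>k ^ i * s + j - r = ?d + (k ^ i * N + j - r)\<close> the first term
    dominates, so the value depends neither on \<open>j\<close> nor on \<open>t\<close>.\<close>
  have at_S: "a (k ^ i * s + j) = (int m * int (\<sigma> * i + ?V (of_nat s - of_nat N)) + v) div int l"
    if s: "s \<in> S" and "t \<ge> T" "of_nat (k ^ i * N + j) \<noteq> r" "?V (of_nat (k ^ i * N + j) - r) = \<sigma> * i + t"
    for s j t
  proof -
    let ?d = "of_nat k ^ i * (of_nat s - of_nat N) :: 'p padic_int"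
    have sN: "of_nat s - of_nat N \<noteq> (0 :: 'p padic_int)" using that(1) N(2) by auto
    have V_d: "?V ?d = \<sigma> * i + ?V (of_nat s - of_nat N)"
      using padic_int_val_mult[OF k0 sN] Vk by simp
    have "?V ?d < \<sigma> * i + t"
      using T0[OF that(1)] that(2) unfolding V_d T_def by linarith
    then have "padic_residue (of_nat (k ^ i * N + j) :: 'p padic_int) (Suc (?V ?d)) = padic_residue r (Suc (?V ?d))"
      unfolding padic_residue_eq_iff_val[OF that(3)] that(4) by simp
    then have "padic_residue (of_nat (k ^ i * N + j) - r) (Suc (?V ?d)) = 0"
      by (simp only: padic_residue_eq_iff_diff)
    moreover have "?d \<noteq> 0" using k0 sN by (simp only: mult_eq_0_iff simp_thms)
    moreover have "?d + (of_nat (k ^ i * N + j) - r) = of_nat (k ^ i * s + j) - r"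
      by (simp add: algebra_simps)
    ultimately have *: "of_nat (k ^ i * s + j) - r \<noteq> 0" "?V (of_nat (k ^ i * s + j) - r) = ?V ?d"
      using padic_int_val_add_dominant by metis+
    obtain q q' where q: "s = ?p ^ e * q" "N = ?p ^ e * q'"
      using N(1) s S(1) unfolding X_def by blast
    have "padic_residue (of_nat s :: 'p padic_int) e = padic_residue (of_nat N :: 'p padic_int) e"
      unfolding q padic_residue_of_nat by simp
    then have "e \<le> ?V (of_nat s - of_nat N)"
      using padic_residue_eq_iff_val[of "of_nat s :: 'p padic_int" "of_nat N" e] sN by simp
    then have "e \<le> ?V (of_nat (k ^ i * s + j) - r)" unfolding *(2) V_d by linarith
    moreover have ne: "of_nat (k ^ i * s + j) \<noteq> r" using *(1) by auto
    ultimately have "padic_residue (of_nat (k ^ i * s + j) :: 'p padic_int) e = padic_residue r e"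
      using padic_residue_eq_iff_val by blast
    from a[OF ne this] show ?thesis unfolding *(2) V_d .
  qed
  obtain j1 where j1: "j1 < k ^ i" "of_nat (k ^ i * N + j1) \<noteq> r"
    "?V (of_nat (k ^ i * N + j1) - r) = \<sigma> * i + T"
    using ex_j[of T] by auto
  obtain j2 where j2: "j2 < k ^ i" "of_nat (k ^ i * N + j2) \<noteq> r"
    "?V (of_nat (k ^ i * N + j2) - r) = \<sigma> * i + (T + l)"
    using ex_j[of "T + l"] by auto
  \<comment> \<open>The two sequences agree on \<open>S\<close> by \<open>at_S\<close>, hence at
    \<open>N\<close>, where \<open>T\<close> and \<open>T + l\<close> give different terms.\<close>
  let ?h = "(\<lambda>n. a (k ^ i * n + j1)) - (\<lambda>n. a (k ^ i * n + j2))"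
  have "?h \<in> int_seq.span F"
    by (rule int_seq.span_diff[OF k_kernel_in_span[OF F(2) j1(1)] k_kernel_in_span[OF F(2) j2(1)]])
  moreover have "\<forall>s\<in>S. ?h s = 0"
    using at_S[OF _ _ j1(2,3)] at_S[OF _ _ j2(2,3)] by simp
  ultimately have "?h N = 0" using N(1) by (rule test)
  then have "a (k ^ i * N + j2) = a (k ^ i * N + j1)" by simp
  then show False
    using at_N[OF _ j1(2,3)] at_N[OF _ j2(2,3)]
      affine_div_step[OF \<open>l \<ge> 1\<close>, of m "\<sigma> * i + T" v] \<open>m \<ge> 1\<close>
    by (simp add: add.assoc)
qed

text \<open>Near the singularity of \<open>b i\<close> the sequences \<open>b q\<close> with
  \<open>q \<in> I\<close> are constant, while \<open>b i\<close> takes different values there.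
  Irrationality keeps the singularities apart: if two coincided, \<open>r\<close> would solve a
  linear equation over the integers.\<close>

lemma irrational_root_imp_not_k_regular:
  fixes r :: "'p::prime_cardinality padic_int" and a :: "nat \<Rightarrow> int"
  assumes "l \<ge> 1" "m \<ge> 1"
    and a: "\<And>n. of_nat n \<noteq> r \<Longrightarrow> padic_residue (of_nat n :: 'p padic_int) e = padic_residue r e \<Longrightarrow>
      a n = (int m * int (padic_int_val (of_nat n - r)) + v) div int l"
    and "\<sigma> \<ge> 1" "of_padic_int r \<notin> \<rat>"
  shows "\<not> k_regular (CARD('p) ^ \<sigma>) a"
proof
  let ?p = "CARD('p)"
  let ?V = "padic_int_val :: 'p padic_int \<Rightarrow> nat"
  assume "k_regular (?p ^ \<sigma>) a"
  then obtain F where F: "finite F" "int_seq.span F = int_seq.span (k_kernel (?p ^ \<sigma>) a)"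
    unfolding k_regular_def by blast
  have p: "1 < ?p" by (rule prime_gt_1_nat[OF prime_CARD])
  \<comment> \<open>The kernel exponent is \<open>i + e\<close> so that \<open>w i \<ge> e\<close>
    and \<open>j i\<close> lies in the class of \<open>r\<close> modulo
    \<open>p ^ e\<close>.\<close>
  define w where "w i = \<sigma> * (i + e)" for i
  have w_e: "e \<le> w i" for i
    using mult_le_mono[OF \<open>\<sigma> \<ge> 1\<close>, of e "i + e"] by (simp add: w_def)
  have ex: "\<exists>j<?p ^ w i. padic_residue (of_nat j :: 'p padic_int) (w i) = padic_residue r (w i)" for i
    by (rule ex_nat_padic_residue)
  define j where "j i = (SOME j. j < ?p ^ w i \<and> padic_residue (of_nat j :: 'p padic_int) (w i) = padic_residue r (w i))" for i
  have j: "j i < ?p ^ w i"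
    "padic_residue (of_nat (j i) :: 'p padic_int) (w i) = padic_residue r (w i)" for i
    unfolding j_def using someI_ex[OF ex[of i]] by blast+
  define b where "b i n = a (?p ^ w i * n + j i)" for i n
  have "b i \<in> int_seq.span F" for i
  proof -
    have "b i = (\<lambda>n. a ((?p ^ \<sigma>) ^ (i + e) * n + j i))"
      by (rule ext) (simp only: b_def w_def power_mult)
    moreover have "j i < (?p ^ \<sigma>) ^ (i + e)" using j(1)[of i] by (simp only: w_def power_mult)
    ultimately show ?thesis by (simp only: k_kernel_in_span[OF F(2)])
  qed
  then have "\<exists>I i. finite I \<and> i \<notin> I \<and> b i \<in> int_seq.span (b ` I)"
    by (rule int_seq_family_dependent[OF F(1)])
  then obtain I i where
    I: "finite I" "i \<notin> I" "b i \<in> int_seq.span (b ` I)"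
    by (elim exE conjE) (rule that)
  \<comment> \<open>Up to the factor \<open>p ^ (w i + w q)\<close>, the difference of the
    singularities \<open>(r - j i) / p ^ w i\<close> and \<open>(r - j q) / p ^ w q\<close>.\<close>
  define D where "D q = of_nat ?p ^ w i * (of_nat (j q) - r) - of_nat ?p ^ w q * (of_nat (j i) - r)" for q
  have D: "D q \<noteq> 0" if "q \<noteq> i" for q
  proof
    assume "D q = 0"
    then have "of_int (int ?p ^ w i - int ?p ^ w q) * r =
        of_int (int ?p ^ w i * int (j q) - int ?p ^ w q * int (j i))"
      by (simp add: D_def algebra_simps)
    then have eq: "of_int (int ?p ^ w i - int ?p ^ w q) * of_padic_int r =
        of_int (int ?p ^ w i * int (j q) - int ?p ^ w q * int (j i))"
      by (metis of_padic_int_mult of_padic_int_of_int)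
    have "w i \<noteq> w q" using that \<open>\<sigma> \<ge> 1\<close> by (simp add: w_def)
    then have "int ?p ^ w i - int ?p ^ w q \<noteq> 0" using p by simp
    then have "(of_int (int ?p ^ w i - int ?p ^ w q) :: 'p padic) \<noteq> 0"
      by (simp only: of_int_eq_0_iff not_False_eq_True)
    then have "of_padic_int r = of_int (int ?p ^ w i * int (j q) - int ?p ^ w q * int (j i)) /
        of_int (int ?p ^ w i - int ?p ^ w q)"
      using eq by (metis nonzero_mult_div_cancel_left)
    then have "of_padic_int r \<in> \<rat>"
      by (simp only: Rats_divide Rats_of_int)
    then show False using \<open>of_padic_int r \<notin> \<rat>\<close> by contradiction
  qed
  \<comment> \<open>From \<open>T\<close> on, the arguments are nearer to the singularity of
    \<open>b i\<close> than to that of any \<open>b q\<close> with \<open>q \<in> I\<close>.\<close>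
  obtain T where T: "\<And>q. q \<in> I \<Longrightarrow> ?V (D q) < T"
    using I(1) finite_nat_set_iff_bounded[of "(\<lambda>q. ?V (D q)) ` I"] by auto
  have ex_n: "\<exists>n. of_nat (?p ^ w i * n + j i) \<noteq> r \<and> ?V (of_nat (?p ^ w i * n + j i) - r) = w i + t" for t
  proof -
    obtain J where J: "of_nat J \<noteq> r" "?V (of_nat J - r) = w i + t"
      using ex_nat_padic_int_val by blast
    \<comment> \<open>Closeness to \<open>r\<close> forces \<open>J\<close> to be congruent to
      \<open>j i\<close> modulo \<open>p ^ w i\<close>, so \<open>J\<close> has the required
      form.\<close>
    have "padic_residue (of_nat J :: 'p padic_int) (w i) = padic_residue r (w i)"
      unfolding padic_residue_eq_iff_val[OF J(1)] J(2) by simp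
    then have "int J mod int ?p ^ w i = int (j i) mod int ?p ^ w i"
      using j(2)[of i] by (simp only: padic_residue_of_nat)
    then have "J mod ?p ^ w i = j i mod ?p ^ w i"
      by (metis of_nat_eq_iff of_nat_mod of_nat_power)
    also have "\<dots> = j i" using j(1) by simp
    finally have "J = ?p ^ w i * (J div ?p ^ w i) + j i" by (metis mult_div_mod_eq)
    then show ?thesis using J by metis
  qed
  have at_i: "b i n = (int m * int (w i + t) + v) div int l"
    if "of_nat (?p ^ w i * n + j i) \<noteq> r" "?V (of_nat (?p ^ w i * n + j i) - r) = w i + t" for n t
  proof -
    have "padic_residue (of_nat (?p ^ w i * n + j i) :: 'p padic_int) e = padic_residue r e"
      unfolding padic_residue_eq_iff_val[OF that(1)] that(2) using w_e[of i] by simp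
    from a[OF that(1) this] show ?thesis unfolding that(2) b_def .
  qed
  have p0: "(of_nat ?p ^ n :: 'p padic_int) \<noteq> 0" for n using p by simp
  have at_I: "b q n = (int m * (int (?V (D q)) - int (w i)) + v) div int l"
    if q: "q \<in> I" and "t \<ge> T" and n: "of_nat (?p ^ w i * n + j i) \<noteq> r"
      "?V (of_nat (?p ^ w i * n + j i) - r) = w i + t" for q n t
  proof -
    let ?x = "of_nat (?p ^ w i * n + j i) - r" and ?y = "of_nat (?p ^ w q * n + j q) :: 'p padic_int"
    have "q \<noteq> i" using q I(2) by blast
    have x: "?x \<noteq> 0" using n(1) by simp
    have "?V (of_nat ?p ^ w q * ?x) = w q + (w i + t)"
      unfolding padic_int_val_mult[OF p0 x] padic_int_val_CARD_power n(2) ..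
    then have "Suc (?V (D q)) \<le> ?V (of_nat ?p ^ w q * ?x)"
      using T[OF q] \<open>t \<ge> T\<close> by linarith
    then have "padic_residue (of_nat ?p ^ w q * ?x :: 'p padic_int) (Suc (?V (D q))) = 0"
      using p0 x by (subst padic_residue_eq_0_iff_val) (simp_all only: mult_eq_0_iff simp_thms)
    note dom = padic_int_val_add_dominant[OF D[OF \<open>q \<noteq> i\<close>] this]
    \<comment> \<open>\<open>D q\<close> dominates by the choice of \<open>T\<close>, so the
      valuation seen by \<open>b q\<close> depends neither on \<open>n\<close> nor on
      \<open>t\<close>.\<close>
    have eq: "D q + of_nat ?p ^ w q * ?x = of_nat ?p ^ w i * (?y - r)"
      by (simp add: D_def algebra_simps)
    have y: "?y - r \<noteq> 0" using dom(1) unfolding eq by auto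
    have "w i + ?V (?y - r) = ?V (D q)"
      using dom(2) unfolding eq padic_int_val_mult[OF p0 y] padic_int_val_CARD_power .
    then have Vy: "int (?V (?y - r)) = int (?V (D q)) - int (w i)" by linarith
    have "padic_residue ?y e = padic_residue (of_nat (j q) :: 'p padic_int) e"
      by (rule padic_residue_CARD_power_mult[OF w_e])
    also have "\<dots> = padic_residue r e"
      by (rule padic_residue_eq_mono[OF j(2) w_e])
    finally have "padic_residue ?y e = padic_residue r e" .
    moreover have "?y \<noteq> r" using y by auto
    ultimately have "a (?p ^ w q * n + j q) = (int m * int (?V (?y - r)) + v) div int l"
      using a by blast
    then show ?thesis unfolding Vy b_def .
  qed
  obtain n1 where n1: "of_nat (?p ^ w i * n1 + j i) \<noteq> r"
    "?V (of_nat (?p ^ w i * n1 + j i) - r) = w i + T" using ex_n by blast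
  obtain n2 where n2: "of_nat (?p ^ w i * n2 + j i) \<noteq> r"
    "?V (of_nat (?p ^ w i * n2 + j i) - r) = w i + (T + l)" using ex_n by blast
  have "b i n2 = b i n1"
    using I(3)
  proof (rule int_seq_span_eq_at)
    fix g assume "g \<in> b ` I"
    then show "g n2 = g n1" using at_I[OF _ _ n1] at_I[OF _ _ n2] by auto
  qed
  then show False
    using at_i[OF n1] at_i[OF n2]
      affine_div_step[OF \<open>l \<ge> 1\<close>, of m "w i + T" v] \<open>m \<ge> 1\<close>
    by (simp add: add.assoc)
qed

text \<open>Splitting off the p-part of \<open>k\<close> leaves a p-free factor that the first
  non-regularity result forces to be 1; the second one then makes \<open>r\<close> rational.\<close>

lemma k_regular_imp_CARD_power:
  fixes f :: "'p::prime_cardinality padic_int \<Rightarrow> 'p padic"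
  assumes "l \<ge> 1" "nu_sequence l f a" "root_class f e r" "k \<ge> 2" "k_regular k a"
  shows "\<exists>\<sigma>\<ge>1. k = CARD('p) ^ \<sigma>" "of_padic_int r \<in> \<rat>"
proof -
  obtain m v where m: "m \<ge> 1"
    and near: "\<And>n. of_nat n \<noteq> r \<Longrightarrow> padic_residue (of_nat n :: 'p padic_int) e = padic_residue r e \<Longrightarrow>
      a n = (int m * int (padic_int_val (of_nat n - r)) + v) div int l"
    using root_class_sequence[OF assms(2,3)] by blast
  have p: "prime CARD('p)" by (rule prime_CARD)
  obtain k' where k': "k = CARD('p) ^ multiplicity CARD('p) k * k'" "\<not> CARD('p) dvd k'"
  proof -
    have "k \<noteq> 0" using assms(4) by simp
    moreover have "\<not> is_unit CARD('p)" using p by (metis not_prime_unit)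
    ultimately show ?thesis by (rule multiplicity_decompose') (rule that)
  qed
  have "\<not> k' \<ge> 2"
    using root_imp_not_k_regular[OF assms(1) m near k'] assms(5) by blast
  moreover have "k' \<noteq> 0" using k'(2) by (metis dvd_0_right)
  ultimately have "k' = 1" by linarith
  with k'(1) have k: "k = CARD('p) ^ multiplicity CARD('p) k" by simp
  have \<sigma>: "multiplicity CARD('p) k \<ge> 1"
  proof (rule ccontr)
    assume "\<not> ?thesis"
    then have "multiplicity CARD('p) k = 0" by simp
    then have "k = 1" using k by simp
    then show False using assms(4) by simp
  qed
  then show "\<exists>\<sigma>\<ge>1. k = CARD('p) ^ \<sigma>" using k by blast
  show "of_padic_int r \<in> \<rat>"
    using irrational_root_imp_not_k_regular[OF assms(1) m near \<sigma>] assms(5) k by auto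
qed

text \<open>A class with a root is not constant, and a root class contains no root besides its
  own.\<close>

lemma root_class_at_root:
  assumes "f x = 0"
    and "constant_class f e x \<or> (\<exists>r. padic_residue r e = padic_residue x e \<and> root_class f e r)"
  shows "root_class f e x"
proof -
  have "\<not> constant_class f e x" using assms(1) by (auto simp: constant_class_def)
  then obtain r where r: "padic_residue r e = padic_residue x e" "root_class f e r"
    using assms(2) by blast
  then have "r = x"
    using assms(1) unfolding root_class_def by metis
  then show ?thesis using r(2) by simp
qed

text \<open>Coprime numbers above 1 are multiplicatively independent and a periodic sequence is
  regular for every base, so \<open>p + 1\<close> refutes strictness. This separates the rootless
  case from the rational one.\<close>

lemma periodic_imp_not_strictly_k_regular:
  assumes "periodic a" "p \<ge> 2"
  shows "\<not> strictly_k_regular p a"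
proof -
  have "coprime p (p + 1)" by simp
  have "mult_independent p (p + 1)"
    unfolding mult_independent_def
  proof (intro allI impI notI)
    fix i j :: nat assume "i \<ge> 1" "j \<ge> 1" and eq: "p ^ i = (p + 1) ^ j"
    have "coprime (p ^ i) ((p + 1) ^ j)"
      using \<open>coprime p (p + 1)\<close> by simp
    then have "p ^ i = 1" unfolding eq by simp
    then show False using \<open>i \<ge> 1\<close> assms(2) by simp
  qed
  moreover have "k_regular (p + 1) a"
    using assms(1) periodic_imp_k_regular by (auto simp: periodic_def)
  moreover have "p + 1 \<ge> 2" using assms(2) by simp
  ultimately show ?thesis unfolding strictly_k_regular_def by blast
qed

section \<open>The three cases\<close>

lemma valuation_sequence_trichotomy:
  fixes f :: "'p::prime_cardinality padic_int \<Rightarrow> 'p padic"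
  assumes "l \<ge> 1" "analytic_Zp f" "\<exists>x. f x \<noteq> 0" "nu_sequence l f a"
  shows "roots_Zp f = {} \<Longrightarrow> \<exists>e. has_period a (CARD('p) ^ e)"
    and "roots_Zp f \<noteq> {} \<Longrightarrow> of_padic_int ` roots_Zp f \<subseteq> \<rat> \<Longrightarrow> strictly_k_regular CARD('p) a"
    and "\<not> of_padic_int ` roots_Zp f \<subseteq> \<rat> \<Longrightarrow> \<not> regular a"
proof -
  obtain e where e: "\<And>x. constant_class f e x \<or>
      (\<exists>r. padic_residue r e = padic_residue x e \<and> root_class f e r)"
    using analytic_Zp_uniform_classes[OF assms(2,3)] by blast
  show "\<exists>e. has_period a (CARD('p) ^ e)" if "roots_Zp f = {}"
  proof -
    have "constant_class f e x" for x
      using e[of x] that by (auto simp: root_class_def roots_Zp_def)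
    then show ?thesis using rootless_imp_power_period[OF assms(4)] by blast
  qed
  show "strictly_k_regular CARD('p) a"
    if roots: "roots_Zp f \<noteq> {}" and rational: "of_padic_int ` roots_Zp f \<subseteq> \<rat>"
    unfolding strictly_k_regular_def
  proof (intro conjI allI impI notI)
    show "k_regular CARD('p) a"
      by (rule rational_roots_imp_CARD_regular[OF assms(1,4) rational e])
    obtain x where "f x = 0" using roots by (auto simp: roots_Zp_def)
    then have x: "root_class f e x" using e by (rule root_class_at_root)
    fix k assume k: "k \<ge> 2" "mult_independent CARD('p) k" "k_regular k a"
    obtain \<sigma> where "\<sigma> \<ge> 1" "k = CARD('p) ^ \<sigma>"
      using k_regular_imp_CARD_power(1)[OF assms(1,4) x k(1,3)] by blast
    then have "CARD('p) ^ \<sigma> = k ^ 1" by simp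
    with k(2) \<open>\<sigma> \<ge> 1\<close> show False unfolding mult_independent_def by blast
  qed
  show "\<not> regular a" if irrational: "\<not> of_padic_int ` roots_Zp f \<subseteq> \<rat>"
  proof
    assume "regular a"
    then obtain k where k: "k \<ge> 2" "k_regular k a" unfolding regular_def by blast
    obtain x where x: "f x = 0" "of_padic_int x \<notin> \<rat>"
      using irrational by (auto simp: roots_Zp_def)
    have "root_class f e x" using x(1) e by (rule root_class_at_root)
    from k_regular_imp_CARD_power(2)[OF assms(1,4) this k] x(2) show False by contradiction
  qed
qed

theorem theorem2p3:
  fixes p l :: nat
    and f :: "'p::prime_cardinality padic_int \<Rightarrow> 'p padic"
    and a :: "nat \<Rightarrow> int"
  assumes "p = CARD('p)"
    and "l \<ge> 1"
    and "analytic_Zp f"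
    and "\<exists>x. f x \<noteq> 0"
    and "nu_sequence l f a"
  shows "(roots_Zp f = {} \<longrightarrow> periodic a \<and> (\<exists>e. has_period a (p ^ e))) \<and>
    (roots_Zp f \<noteq> {} \<and> of_padic_int ` roots_Zp f \<subseteq> \<rat> \<longrightarrow> strictly_k_regular p a) \<and>
    (\<not> of_padic_int ` roots_Zp f \<subseteq> \<rat> \<longrightarrow> \<not> regular a) \<and>
    (\<forall>l' a'. l' \<ge> 1 \<and> nu_sequence l' f a' \<longrightarrow>
      (periodic a \<longleftrightarrow> periodic a') \<and>
      (strictly_k_regular p a \<longleftrightarrow> strictly_k_regular p a') \<and>
      (regular a \<longleftrightarrow> regular a'))"
proof -
  have p: "p \<ge> 2" unfolding assms(1) by (rule prime_ge_2_nat[OF prime_CARD])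
  have period: "periodic a' \<and> (\<exists>e. has_period a' (p ^ e))"
    if "roots_Zp f = {}" "l' \<ge> 1" "nu_sequence l' f a'" for l' a'
    using valuation_sequence_trichotomy(1)[OF that(2) assms(3,4) that(3,1)]
    unfolding periodic_def assms(1) by blast
  have strict: "strictly_k_regular p a'"
    if "roots_Zp f \<noteq> {}" "of_padic_int ` roots_Zp f \<subseteq> \<rat>" "l' \<ge> 1" "nu_sequence l' f a'" for l' a'
    using valuation_sequence_trichotomy(2)[OF that(3) assms(3,4) that(4,1,2)] unfolding assms(1) .
  have irregular: "\<not> regular a'"
    if "\<not> of_padic_int ` roots_Zp f \<subseteq> \<rat>" "l' \<ge> 1" "nu_sequence l' f a'" for l' a'
    by (rule valuation_sequence_trichotomy(3)[OF that(2) assms(3,4) that(3,1)])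
  have strict_regular: "regular a'" if "strictly_k_regular p a'" for a'
    using that p unfolding strictly_k_regular_def regular_def by blast
  have periodic_regular: "regular a'" if "periodic a'" for a'
    using that periodic_imp_k_regular unfolding periodic_def regular_def by blast
  \<comment> \<open>The cases exclude each other, so each property of the sequence is equivalent to
    a condition on the roots alone, which does not mention \<open>l'\<close>.\<close>
  have types: "(periodic a' \<longleftrightarrow> roots_Zp f = {}) \<and>
      (strictly_k_regular p a' \<longleftrightarrow> roots_Zp f \<noteq> {} \<and> of_padic_int ` roots_Zp f \<subseteq> \<rat>) \<and>
      (regular a' \<longleftrightarrow> of_padic_int ` roots_Zp f \<subseteq> \<rat>)"
    if "l' \<ge> 1" "nu_sequence l' f a'" for l' a'
    using period[OF _ that] strict[OF _ _ that] irregular[OF _ that] strict_regular periodic_regular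
      periodic_imp_not_strictly_k_regular[OF _ p, of a'] by blast
  show ?thesis
    using period[OF _ assms(2,5)] types[OF assms(2,5)] types by blast
qed

end
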